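(* $\mathrm{RD}\equiv\mathrm{WRD}\equiv\mathrm{RTI}\equiv\mathrm{WRTI}\equiv\mathrm{RTL}\equiv\mathrm{WRTL}$, i.e. these six refutation systems are pairwise p-equivalent.
   Context: Clauses are finite sets of literals; $\Box$ is the empty clause. Resolution: from $C_0\ni x$ and $C_1\ni\overline x$ infer $(C_0\setminus\{x\})\cup(C_1\setminus\{\overline x\})$. W-resolution: from arbitrary $C_0,C_1$ and a variable $x$ infer $(C_0\setminus\{x\})\cup(C_1\setminus\{\overline x\})$. RD: a finite dag of clause-labeled nodes with a unique out-degree-$0$ node (the conclusion); in-degree-$0$ nodes labeled by initial clauses; every other node has in-degree $2$ and is labeled by a variable $x$ and the resolvent on $x$ of its predecessors' clauses. WRD: same with w-resolution. RTL: an ordered binary tree $T$ with post-order $<_T$ (nodes of the left subtree of $u$ precede those of the right subtree, which precede $u$) where each leaf $v$ is labeled by an initial clause or by a clause labeling some node $u<_T v$ (a lemma), each internal node is labeled by a variable $x$ and the resolvent on $x$ of its children's clauses, the root being the conclusion. WRTL: same with w-resolution. An input resolution tree is a tree using only (genuine) resolution in which every internal node has at least one leaf child; a node $v$ of $T$ is input-derived if the subtree rooted at $v$ is an input resolution tree. RTI (resp. WRTI): an RTL (resp. WRTL) in which every leaf $v$ not labeled by an initial clause is labeled by a clause labeling some input-derived node $u<_T v$. A refutation of a set $F$ of clauses is a proof of $\Box$ from $F$; size = number of nodes. For refutation systems $Q,R$: $Q$ p-simulates $R$ if there is a polynomial $p$ and a polynomial-time procedure converting every $R$-refutation of size $n$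 of any $F$ into a $Q$-refutation of $F$ of size at most $p(n)$; $Q\equiv R$ (p-equivalent) means each p-simulates the other. *)

theory Defs
  imports "HOL-Library.FSet" "HOL-Computational_Algebra.Polynomial"
begin

section \<open>Clauses and resolution\<close>

type_synonym var = nat

datatype literal = Pos var | Neg var

type_synonym clause = "literal fset"

definition resolvent :: "var \<Rightarrow> clause \<Rightarrow> clause \<Rightarrow> clause" where
  "resolvent x C0 C1 = (C0 |-| {|Pos x|}) |\<union>| (C1 |-| {|Neg x|})"

type_synonym rule = "var \<Rightarrow> clause \<Rightarrow> clause \<Rightarrow> clause \<Rightarrow> bool"

definition resolution :: rule where
  "resolution x C0 C1 C \<longleftrightarrow> Pos x |\<in>| C0 \<and> Neg x |\<in>| C1 \<and> C = resolvent x C0 C1"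

definition w_resolution :: rule where
  "w_resolution x C0 C1 C \<longleftrightarrow> C = resolvent x C0 C1"

text \<open>Neither the order of the two children in a tree nor the order in which a dag node lists
  its predecessors determines which of the two clauses plays the role of \<open>C0\<close>.\<close>

definition inferred :: "rule \<Rightarrow> rule" where
  "inferred rl x C D E \<longleftrightarrow> rl x C D E \<or> rl x D C E"


section \<open>Resolution dags\<close>

text \<open>The nodes of a dag are the positions \<open>0, \<dots>, n - 1\<close> of a list. The list need not be
  topologically sorted. An inner node carries its two predecessors, a variable and a clause.\<close>

datatype dag_node = Source clause | Inner nat nat var clause

type_synonym dag = "dag_node list"

primrec preds :: "dag_node \<Rightarrow> nat set" where
  "preds (Source C) = {}"
| "preds (Inner i j x C) = {i, j}"

primrec node_clause :: "dag_node \<Rightarrow> clause" where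
  "node_clause (Source C) = C"
| "node_clause (Inner i j x C) = C"

definition dag_edges :: "dag \<Rightarrow> (nat \<times> nat) set" where
  "dag_edges D = {(i, k). k < length D \<and> i \<in> preds (D ! k)}"

definition sinks :: "dag \<Rightarrow> nat set" where
  "sinks D = {r. r < length D \<and> (\<forall>k. (r, k) \<notin> dag_edges D)}"

definition dag_derivation :: "rule \<Rightarrow> clause set \<Rightarrow> dag \<Rightarrow> bool" where
  "dag_derivation rl F D \<longleftrightarrow>
     acyclic (dag_edges D) \<and>
     (\<forall>k < length D. case D ! k of
        Source C \<Rightarrow> C \<in> F
      | Inner i j x C \<Rightarrow> i < length D \<and> j < length D \<and> i \<noteq> j \<and>
          inferred rl x (node_clause (D ! i)) (node_clause (D ! j)) C)"

definition dag_refutation :: "rule \<Rightarrow> clause set \<Rightarrow> dag \<Rightarrow> bool" where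
  "dag_refutation rl F D \<longleftrightarrow>
     dag_derivation rl F D \<and> (\<exists>r. sinks D = {r} \<and> node_clause (D ! r) = {||})"


section \<open>Resolution trees with lemmas\<close>

datatype tree = Leaf clause | Node tree var clause tree

primrec tree_clause :: "tree \<Rightarrow> clause" where
  "tree_clause (Leaf C) = C"
| "tree_clause (Node l x C r) = C"

text \<open>A node of \<open>T\<close> is a position in the list \<open>postorder T\<close>, which holds at that position
  the subtree rooted at the node. The relation \<open>u <\<^sub>T v\<close> is \<open><\<close> on positions.\<close>

primrec postorder :: "tree \<Rightarrow> tree list" where
  "postorder (Leaf C) = [Leaf C]"
| "postorder (Node l x C r) = postorder l @ postorder r @ [Node l x C r]"

primrec input_resolution_tree :: "tree \<Rightarrow> bool" where
  "input_resolution_tree (Leaf C) = True"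
| "input_resolution_tree (Node l x C r) =
     (inferred resolution x (tree_clause l) (tree_clause r) C \<and>
      ((\<exists>D. l = Leaf D) \<or> (\<exists>D. r = Leaf D)) \<and>
      input_resolution_tree l \<and> input_resolution_tree r)"

text \<open>The parameter \<open>adm\<close> says which nodes, given by the subtrees rooted at them, may be
  reused as lemmas.\<close>

definition tree_derivation :: "(tree \<Rightarrow> bool) \<Rightarrow> rule \<Rightarrow> clause set \<Rightarrow> tree \<Rightarrow> bool" where
  "tree_derivation adm rl F T \<longleftrightarrow>
     (\<forall>v < length (postorder T). case postorder T ! v of
        Leaf C \<Rightarrow> C \<in> F \<or>
          (\<exists>u < v. adm (postorder T ! u) \<and> tree_clause (postorder T ! u) = C)
      | Node l x C r \<Rightarrow> inferred rl x (tree_clause l) (tree_clause r) C)"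

definition tree_refutation :: "(tree \<Rightarrow> bool) \<Rightarrow> rule \<Rightarrow> clause set \<Rightarrow> tree \<Rightarrow> bool" where
  "tree_refutation adm rl F T \<longleftrightarrow> tree_derivation adm rl F T \<and> tree_clause T = {||}"


section \<open>The six refutation systems\<close>

datatype refutation = Dag dag | Tree tree

primrec refutation_size :: "refutation \<Rightarrow> nat" where
  "refutation_size (Dag D) = length D"
| "refutation_size (Tree T) = length (postorder T)"

type_synonym system = "clause set \<Rightarrow> refutation \<Rightarrow> bool"

definition RD :: system where
  "RD F \<pi> \<longleftrightarrow> (\<exists>D. \<pi> = Dag D \<and> dag_refutation resolution F D)"

definition WRD :: system where
  "WRD F \<pi> \<longleftrightarrow> (\<exists>D. \<pi> = Dag D \<and> dag_refutation w_resolution F D)"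

definition RTL :: system where
  "RTL F \<pi> \<longleftrightarrow> (\<exists>T. \<pi> = Tree T \<and> tree_refutation (\<lambda>_. True) resolution F T)"

definition WRTL :: system where
  "WRTL F \<pi> \<longleftrightarrow> (\<exists>T. \<pi> = Tree T \<and> tree_refutation (\<lambda>_. True) w_resolution F T)"

definition RTI :: system where
  "RTI F \<pi> \<longleftrightarrow> (\<exists>T. \<pi> = Tree T \<and> tree_refutation input_resolution_tree resolution F T)"

definition WRTI :: system where
  "WRTI F \<pi> \<longleftrightarrow> (\<exists>T. \<pi> = Tree T \<and> tree_refutation input_resolution_tree w_resolution F T)"


section \<open>Polynomial-time procedures\<close>

text \<open>The machine model is a first-order, call-by-value functional language over binary trees
  (Lisp S-expressions with a single atom), in the style of Jones' language F. A program is a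
  finite list of function bodies; \<open>Arg i\<close> is the \<open>i\<close>-th argument of the function being
  evaluated, and \<open>Call f es\<close> calls the \<open>f\<close>-th function of the program.

  Every evaluation step costs 1, except that building a pair costs the size of the pair.
  Hence a value that occurs in a computation is never larger than the input plus the time
  spent, and the functions computable in polynomial time are the usual ones: a Turing machine
  can carry out a computation of cost \<open>t\<close> in time polynomial in \<open>t\<close> and the size of the input,
  and a Turing machine can be simulated with polynomial overhead.\<close>

datatype sexp = Atom | Pair sexp sexp

primrec sexp_size :: "sexp \<Rightarrow> nat" where
  "sexp_size Atom = 1"
| "sexp_size (Pair a b) = Suc (sexp_size a + sexp_size b)"

primrec sfst :: "sexp \<Rightarrow> sexp" where
  "sfst Atom = Atom"
| "sfst (Pair a b) = a"

primrec ssnd :: "sexp \<Rightarrow> sexp" where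
  "ssnd Atom = Atom"
| "ssnd (Pair a b) = b"

datatype exp =
    Arg nat
  | AtomE
  | PairE exp exp
  | FstE exp
  | SndE exp
  | IfE exp exp exp
  | Call nat "exp list"

type_synonym program = "exp list"

text \<open>\<open>eval P env e v t\<close>: in program \<open>P\<close>, under the arguments \<open>env\<close>, the expression \<open>e\<close>
  evaluates to \<open>v\<close> at cost \<open>t\<close>. In a conditional, \<open>Atom\<close> counts as false.\<close>

inductive eval :: "program \<Rightarrow> sexp list \<Rightarrow> exp \<Rightarrow> sexp \<Rightarrow> nat \<Rightarrow> bool"
  and evals :: "program \<Rightarrow> sexp list \<Rightarrow> exp list \<Rightarrow> sexp list \<Rightarrow> nat \<Rightarrow> bool"
  for P :: program
where
  eval_Arg: "i < length env \<Longrightarrow> eval P env (Arg i) (env ! i) 1"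
| eval_Atom: "eval P env AtomE Atom 1"
| eval_Pair: "\<lbrakk>eval P env e1 v1 t1; eval P env e2 v2 t2\<rbrakk> \<Longrightarrow>
    eval P env (PairE e1 e2) (Pair v1 v2) (t1 + t2 + sexp_size (Pair v1 v2))"
| eval_Fst: "eval P env e v t \<Longrightarrow> eval P env (FstE e) (sfst v) (t + 1)"
| eval_Snd: "eval P env e v t \<Longrightarrow> eval P env (SndE e) (ssnd v) (t + 1)"
| eval_If_true: "\<lbrakk>eval P env e0 v0 t0; v0 \<noteq> Atom; eval P env e1 v t\<rbrakk> \<Longrightarrow>
    eval P env (IfE e0 e1 e2) v (t0 + t + 1)"
| eval_If_false: "\<lbrakk>eval P env e0 Atom t0; eval P env e2 v t\<rbrakk> \<Longrightarrow>
    eval P env (IfE e0 e1 e2) v (t0 + t + 1)"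
| eval_Call: "\<lbrakk>evals P env es vs t0; f < length P; eval P vs (P ! f) v t\<rbrakk> \<Longrightarrow>
    eval P env (Call f es) v (t0 + t + 1)"
| evals_Nil: "evals P env [] [] 0"
| evals_Cons: "\<lbrakk>eval P env e v t; evals P env es vs t'\<rbrakk> \<Longrightarrow>
    evals P env (e # es) (v # vs) (t + t')"

definition runs :: "program \<Rightarrow> sexp \<Rightarrow> sexp \<Rightarrow> nat \<Rightarrow> bool" where
  "runs P v w t \<longleftrightarrow> eval P [v] (Call 0 [Arg 0]) w t"

definition poly_time_on :: "sexp set \<Rightarrow> (sexp \<Rightarrow> sexp) \<Rightarrow> bool" where
  "poly_time_on A f \<longleftrightarrow>
     (\<exists>(P :: program) (q :: nat poly). \<forall>v \<in> A. \<exists>t \<le> poly q (sexp_size v). runs P v (f v) t)"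


section \<open>Encoding refutations\<close>

text \<open>Variables are written in binary, least significant bit first. Pointers to dag nodes are
  written in unary; since they are smaller than the number of nodes, this affects the length of
  an encoding only polynomially.\<close>

definition enc_bool :: "bool \<Rightarrow> sexp" where
  "enc_bool b = (if b then Pair Atom Atom else Atom)"

fun enc_binary :: "nat \<Rightarrow> sexp" where
  "enc_binary n = (if n = 0 then Atom else Pair (enc_bool (odd n)) (enc_binary (n div 2)))"

declare enc_binary.simps [simp del]

primrec enc_unary :: "nat \<Rightarrow> sexp" where
  "enc_unary 0 = Atom"
| "enc_unary (Suc n) = Pair Atom (enc_unary n)"

primrec enc_list :: "sexp list \<Rightarrow> sexp" where
  "enc_list [] = Atom"
| "enc_list (v # vs) = Pair v (enc_list vs)"

primrec enc_literal :: "literal \<Rightarrow> sexp" where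
  "enc_literal (Pos x) = Pair (enc_bool True) (enc_binary x)"
| "enc_literal (Neg x) = Pair (enc_bool False) (enc_binary x)"

text \<open>A clause is written as a list of its literals without repetitions, in any order. So a
  refutation may have several encodings; an encoding determines the refutation.\<close>

definition encodes_clause :: "clause \<Rightarrow> sexp \<Rightarrow> bool" where
  "encodes_clause C v \<longleftrightarrow>
     (\<exists>ls. distinct ls \<and> set ls = fset C \<and> v = enc_list (map enc_literal ls))"

primrec encodes_node :: "dag_node \<Rightarrow> sexp \<Rightarrow> bool" where
  "encodes_node (Source C) v \<longleftrightarrow> (\<exists>c. encodes_clause C c \<and> v = Pair Atom c)"
| "encodes_node (Inner i j x C) v \<longleftrightarrow> (\<exists>c. encodes_clause C c \<and>
     v = Pair (Pair (enc_unary i) (enc_unary j)) (Pair (enc_binary x) c))"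

primrec encodes_tree :: "tree \<Rightarrow> sexp \<Rightarrow> bool" where
  "encodes_tree (Leaf C) v \<longleftrightarrow> (\<exists>c. encodes_clause C c \<and> v = Pair Atom c)"
| "encodes_tree (Node l x C r) v \<longleftrightarrow> (\<exists>a b c.
     encodes_tree l a \<and> encodes_tree r b \<and> encodes_clause C c \<and>
     v = Pair (Pair a b) (Pair (enc_binary x) c))"

primrec encodes :: "refutation \<Rightarrow> sexp \<Rightarrow> bool" where
  "encodes (Dag D) v \<longleftrightarrow>
     (\<exists>vs. list_all2 encodes_node D vs \<and> v = Pair (enc_bool False) (enc_list vs))"
| "encodes (Tree T) v \<longleftrightarrow> (\<exists>w. encodes_tree T w \<and> v = Pair (enc_bool True) w)"


section \<open>Simulations\<close>

text \<open>The procedure \<open>f\<close> sees only the refutation, not \<open>F\<close>. Its running time is measured in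
  the length of the encoding, whereas the size of its result is bounded by a polynomial in the
  number of nodes.\<close>

definition p_simulates :: "system \<Rightarrow> system \<Rightarrow> bool" where
  "p_simulates Q R \<longleftrightarrow> (\<exists>(p :: nat poly) (f :: sexp \<Rightarrow> sexp).
     poly_time_on {v. \<exists>F \<pi>. R F \<pi> \<and> encodes \<pi> v} f \<and>
     (\<forall>F \<pi> v. R F \<pi> \<and> encodes \<pi> v \<longrightarrow>
        (\<exists>\<pi>'. encodes \<pi>' (f v) \<and> Q F \<pi>' \<and>
           refutation_size \<pi>' \<le> poly p (refutation_size \<pi>))))"

definition p_equivalent :: "system \<Rightarrow> system \<Rightarrow> bool" where
  "p_equivalent Q R \<longleftrightarrow> p_simulates Q R \<and> p_simulates R Q"

end

theory Submission
  imports Defs "HOL-Library.While_Combinator"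
begin

text \<open>Two procedures suffice, because every one of the six systems extends RD or RTI and is
  contained in WRD or WRTL: one that turns WRD and WRTL refutations into RD refutations, and one
  that turns them into RTI refutations.

  Both first compute a list of clauses with genuine resolution derivations, such that every clause
  of the given refutation has a subclause in the list. The nodes are scanned repeatedly, and for
  each node whose clause \<open>C\<close> is not yet subsumed a resolvent of two listed clauses inside \<open>C\<close> is
  searched. If \<open>C\<close> is a w-resolvent of \<open>A\<close> and \<open>B\<close> on \<open>x\<close> and the listed subclauses of \<open>A\<close> and
  \<open>B\<close> are not contained in \<open>C\<close>, then they contain \<open>x\<close> and its negation, so genuine resolution
  applies to them. For a tree, one scan in postorder does everything; a leaf that is not an initial
  clause is subsumed when it is reached. For a dag, each scan covers one more layer.

  The clauses of the list needed for the empty clause form a resolution dag. For RTI, this dag is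
  unfolded depth first, where an inner clause becomes a lemma once both of its premises are leaves.
  Each lowest inner node of the resulting tree learns a new clause, so a dag with \<open>n\<close> nodes yields
  at most \<open>n\<close> lowest inner nodes, each with at most \<open>n\<close> ancestors.

  Polynomial running time is obtained from closure properties: composition, conditionals, loops
  whose number of iterations and intermediate values are polynomially bounded, and the list
  operations derived from them.\<close>

section \<open>Functions computable in polynomial time\<close>

text \<open>The interface shapes the procedures in three ways. They receive an encoding but not the
  set \<open>F\<close>, so a leaf used as a lemma cannot be told from an initial clause; only
  coverage by earlier clauses separates the two. Time is polynomial in the length of the encoding,
  but size is polynomial in the number of nodes, so the list of clauses must be bounded by counting
  nodes rather than by running time. And \<open>ptime\<close> speaks about all S-expressions, so
  every growth estimate has to hold for malformed inputs as well, where no semantic invariant is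
  available. Once clauses shrink, the recorded premises of a node may no longer be the right ones.
  Saturation therefore reads only the clause and the pivot of a node and searches for premises. It
  follows no pointer, which is why one procedure serves unsorted dags and flattened trees. In the
  unfolding, a node with two leaf children is certainly input-derived, whereas a larger subtree need
  not be. This fixes which clauses are learned, and it means that other clauses may be derived
  several times.\<close>

lemma poly_nat_mono:
  fixes p :: "nat poly"
  assumes "m \<le> n"
  shows "poly p m \<le> poly p n"
  by (induction p) (auto intro!: add_mono mult_mono assms)

section \<open>Relocation of programs and the cost of a call\<close>

primrec shift :: "nat \<Rightarrow> exp \<Rightarrow> exp" where
  "shift k (Arg i) = Arg i"
| "shift k AtomE = AtomE"
| "shift k (PairE a b) = PairE (shift k a) (shift k b)"
| "shift k (FstE a) = FstE (shift k a)"
| "shift k (SndE a) = SndE (shift k a)"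
| "shift k (IfE a b c) = IfE (shift k a) (shift k b) (shift k c)"
| "shift k (Call f es) = Call (f + k) (map (shift k) es)"

text \<open>Evaluation reaches other bodies only through their index. A program whose calls are
  renumbered by the number of functions in front of it therefore runs at the same cost inside any
  larger program.\<close>

lemma eval_link:
  "eval P env e v t \<Longrightarrow>
    eval (R @ map (shift (length R)) P @ S) env (shift (length R) e) v t"
  "evals P env es vs t' \<Longrightarrow>
    evals (R @ map (shift (length R)) P @ S) env (map (shift (length R)) es) vs t'"
proof (induction rule: eval_evals.inducts)
  case (eval_Call env es vs t0 f v t)
  have "eval (R @ map (shift (length R)) P @ S) vs
      ((R @ map (shift (length R)) P @ S) ! (f + length R)) v t"
    using eval_Call by (simp add: nth_append)
  with eval_Call(2,3) show ?case
    using eval_evals.eval_Call[of "R @ map (shift (length R)) P @ S" env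
        "map (shift (length R)) es" vs t0 "f + length R" v t] by simp
qed (auto intro: eval_evals.intros eval_evals.intros[simplified])

text \<open>Only \<open>PairE\<close> creates a new compound value, and it is charged the full size
  of that value; without this charge, repeated duplication would give exponential values in linear
  time. The bound \<open>M\<close> varies in the induction because a called body runs under
  arguments as large as \<open>M + t0\<close>.\<close>

lemma eval_size:
  "eval P env e v t \<Longrightarrow> (\<And>a. a \<in> set env \<Longrightarrow> sexp_size a \<le> M) \<Longrightarrow> sexp_size v \<le> M + t"
  "evals P env es vs t' \<Longrightarrow> (\<And>a. a \<in> set env \<Longrightarrow> sexp_size a \<le> M) \<Longrightarrow>
    \<forall>a \<in> set vs. sexp_size a \<le> M + t'"
proof (induction arbitrary: M and M rule: eval_evals.inducts)
  case (eval_Arg i env)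
  then show ?case by (simp add: le_SucI)
next
  case (eval_Fst env e v t)
  then have "sexp_size v \<le> M + t" by blast
  then show ?case by (cases v) auto
next
  case (eval_Snd env e v t)
  then have "sexp_size v \<le> M + t" by blast
  then show ?case by (cases v) auto
next
  case (eval_If_true env e0 v0 t0 e1 v t e2)
  then have "sexp_size v \<le> M + t" by blast
  then show ?case by auto
next
  case (eval_If_false env e0 t0 e2 v t e1)
  then have "sexp_size v \<le> M + t" by blast
  then show ?case by auto
next
  case (eval_Call env es vs t0 f v t)
  then have "sexp_size v \<le> (M + t0) + t" by blast
  then show ?case by auto
next
  case (evals_Cons env e v t es vs t')
  then have "sexp_size v \<le> M + t" "\<forall>a \<in> set vs. sexp_size a \<le> M + t'" by blast+
  then show ?case by fastforce
qed auto

text \<open>Measured at the body of function \<open>i\<close>, without the surrounding call, so that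
  several functions of one program can be tracked together.\<close>

definition computes :: "program \<Rightarrow> nat \<Rightarrow> (sexp \<Rightarrow> sexp) \<Rightarrow> nat poly \<Rightarrow> bool" where
  "computes P i f q \<longleftrightarrow> i < length P \<and>
     (\<forall>v. \<exists>t \<le> poly q (sexp_size v). eval P [v] (P ! i) (f v) t)"

definition ptime :: "(sexp \<Rightarrow> sexp) \<Rightarrow> bool" where
  "ptime f \<longleftrightarrow> poly_time_on UNIV f"

definition pdec :: "(sexp \<Rightarrow> bool) \<Rightarrow> bool" where
  "pdec c \<longleftrightarrow> ptime (\<lambda>v. enc_bool (c v))"

lemma computes_call:
  assumes "computes P i f q" and "eval P env e v t"
  shows "\<exists>t' \<le> t + poly q (sexp_size v) + 1. eval P env (Call i [e]) (f v) t'"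
proof -
  obtain s where s: "s \<le> poly q (sexp_size v)" "eval P [v] (P ! i) (f v) s"
    using assms(1) by (auto simp: computes_def)
  have "evals P env [e] [v] (t + 0)"
    by (intro evals_Cons evals_Nil assms(2))
  then have "eval P env (Call i [e]) (f v) (t + s + 1)"
    using eval_Call[of P env "[e]" "[v]" "t + 0" i "f v" s] s assms(1) by (simp add: computes_def)
  then show ?thesis using s(1) by (intro exI[of _ "t + s + 1"]) auto
qed

lemma computes_call_arg:
  assumes "computes P i f q"
  shows "\<exists>t \<le> poly q (sexp_size v) + 2. eval P [v] (Call i [Arg 0]) (f v) t"
  using computes_call[OF assms eval_Arg[of 0 "[v]"]] by simp

lemma ptime_iff: "ptime f \<longleftrightarrow> (\<exists>P q. computes P 0 f q)"
proof
  assume "ptime f"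
  then obtain P q where *: "\<And>v. \<exists>t \<le> poly q (sexp_size v). runs P v (f v) t"
    unfolding ptime_def poly_time_on_def by auto
  have "\<exists>t \<le> poly q (sexp_size v). 0 < length P \<and> eval P [v] (P ! 0) (f v) t" for v
  proof -
    obtain t where t: "t \<le> poly q (sexp_size v)" "eval P [v] (Call 0 [Arg 0]) (f v) t"
      using * unfolding runs_def by blast
    from t(2) obtain vs t0 s where s: "evals P [v] [Arg 0] vs t0" "0 < length P"
        "eval P vs (P ! 0) (f v) s" "t = t0 + s + 1"
      by (cases rule: eval.cases) auto
    from s(1) have "vs = [v]"
      by (auto elim!: evals.cases[of _ _ "_ # _"] evals.cases[of _ _ "[]"] eval.cases[of _ _ "Arg 0"])
    with s t(1) show ?thesis by (intro exI[of _ s]) auto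
  qed
  then show "\<exists>P q. computes P 0 f q"
    unfolding computes_def by blast
next
  assume "\<exists>P q. computes P 0 f q"
  then obtain P q where "computes P 0 f q" by blast
  from computes_call_arg[OF this] show "ptime f"
    unfolding ptime_def poly_time_on_def runs_def
    \<comment> \<open>The outer call adds 2: one unit for \<open>Arg 0\<close> and one for the call
      itself.\<close>
    by (intro exI[of _ P] exI[of _ "q + [:2:]"]) simp
qed

lemma ptimeI:
  assumes "P \<noteq> []" and "\<And>v. \<exists>t \<le> poly q (sexp_size v). eval P [v] (P ! 0) (f v) t"
  shows "ptime f"
  unfolding ptime_iff computes_def using assms by blast

lemma computes_link:
  assumes "computes P i f q"
  shows "computes (R @ map (shift (length R)) P @ S) (length R + i) f q"
  using assms eval_link(1)[of P _ "P ! i" _ _ R S]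
  unfolding computes_def by (fastforce simp: nth_append)

text \<open>The indices \<open>i\<close>, \<open>j\<close>, \<open>k\<close> are fixed before the
  front part \<open>M\<close>, of which only the length is known; hence the functions in
  \<open>M\<close> can be written so as to call them. Three slots are what a conditional or a loop
  needs.\<close>

lemma ptime_link:
  assumes "ptime f" "ptime g" "ptime h"
  shows "\<exists>Q i j k p q r. \<forall>M. length M = m \<longrightarrow>
    computes (M @ Q) i f p \<and> computes (M @ Q) j g q \<and> computes (M @ Q) k h r"
proof -
  obtain A B C p q r where *: "computes A 0 f p" "computes B 0 g q" "computes C 0 h r"
    using assms by (auto simp: ptime_iff)
  define A' B' C' where "A' = map (shift m) A" and "B' = map (shift (m + length A)) B"
    and "C' = map (shift (m + length A + length B)) C"
  have "computes (M @ A' @ B' @ C') m f p \<and> computes (M @ A' @ B' @ C') (m + length A) g q \<and>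
      computes (M @ A' @ B' @ C') (m + length A + length B) h r" if "length M = m" for M
    using computes_link[OF *(1), of M "B' @ C'"] computes_link[OF *(2), of "M @ A'" "C'"]
      computes_link[OF *(3), of "M @ A' @ B'" "[]"] that
    by (simp add: A'_def B'_def C'_def add.assoc)
  then show ?thesis by blast
qed

lemma ptime_size:
  assumes "ptime f"
  shows "\<exists>q. \<forall>v. sexp_size (f v) \<le> poly q (sexp_size v)"
proof -
  obtain P q where *: "computes P 0 f q" using assms by (auto simp: ptime_iff)
  have "sexp_size (f v) \<le> poly ([:0, 1:] + q) (sexp_size v)" for v
  proof -
    obtain t where "t \<le> poly q (sexp_size v)" "eval P [v] (P ! 0) (f v) t"
      using * by (auto simp: computes_def)
    then show ?thesis using eval_size(1)[of P "[v]" "P ! 0" "f v" t "sexp_size v"] by auto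
  qed
  then show ?thesis by blast
qed

section \<open>Closure under composition, pairing, branching and loops\<close>

lemma ptime_id: "ptime (\<lambda>v. v)"
proof (rule ptimeI)
  show "\<exists>t \<le> poly 1 (sexp_size v). eval [Arg 0] [v] ([Arg 0] ! 0) v t" for v
    using eval_Arg[of 0 "[v]" "[Arg 0]"] by auto
qed simp

lemma ptime_Atom: "ptime (\<lambda>v. Atom)"
proof (rule ptimeI)
  show "\<exists>t \<le> poly 1 (sexp_size v). eval [AtomE] [v] ([AtomE] ! 0) Atom t" for v
    using eval_Atom[of "[AtomE]" "[v]"] by auto
qed simp

lemma ptime_comp:
  assumes "ptime g" "ptime f"
  shows "ptime (\<lambda>v. g (f v))"
proof -
  obtain Q i j k p q r where *: "\<And>M. length M = 1 \<Longrightarrow>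
      computes (M @ Q) i f p \<and> computes (M @ Q) j g q \<and> computes (M @ Q) k f r"
    using ptime_link[OF assms(2,1,2), of 1] by blast
  obtain b where b: "\<And>v. sexp_size (f v) \<le> poly b (sexp_size v)"
    using ptime_size[OF assms(2)] by blast
  define P where "P = [Call j [Call i [Arg 0]]] @ Q"
  have P: "computes P i f p" "computes P j g q" using *[of "[_]"] by (simp_all add: P_def)
  show ?thesis
  proof (rule ptimeI)
    fix v
    obtain t where t: "t \<le> poly p (sexp_size v) + 2" "eval P [v] (Call i [Arg 0]) (f v) t"
      using computes_call_arg[OF P(1)] by blast
    obtain t' where t': "t' \<le> t + poly q (sexp_size (f v)) + 1" "eval P [v] (P ! 0) (g (f v)) t'"
      using computes_call[OF P(2) t(2)] by (auto simp: P_def)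
    have "t' \<le> poly (p + pcompose q b + [:3:]) (sexp_size v)"
      using t(1) t'(1) poly_nat_mono[OF b, of q v] by (simp add: poly_pcompose)
    then show "\<exists>t \<le> poly (p + pcompose q b + [:3:]) (sexp_size v). eval P [v] (P ! 0) (g (f v)) t"
      using t'(2) by blast
  qed (simp add: P_def)
qed

lemma ptime_sfst:
  assumes "ptime f"
  shows "ptime (\<lambda>v. sfst (f v))"
proof -
  have "ptime sfst"
  proof (rule ptimeI)
    show "\<exists>t \<le> poly [:2:] (sexp_size v). eval [FstE (Arg 0)] [v] ([FstE (Arg 0)] ! 0) (sfst v) t" for v
      using eval_Fst[OF eval_Arg[of 0 "[v]" "[FstE (Arg 0)]"]] by (auto simp: numeral_2_eq_2)
  qed simp
  then show ?thesis using assms by (rule ptime_comp)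
qed

lemma ptime_ssnd:
  assumes "ptime f"
  shows "ptime (\<lambda>v. ssnd (f v))"
proof -
  have "ptime ssnd"
  proof (rule ptimeI)
    show "\<exists>t \<le> poly [:2:] (sexp_size v). eval [SndE (Arg 0)] [v] ([SndE (Arg 0)] ! 0) (ssnd v) t" for v
      using eval_Snd[OF eval_Arg[of 0 "[v]" "[SndE (Arg 0)]"]] by (auto simp: numeral_2_eq_2)
  qed simp
  then show ?thesis using assms by (rule ptime_comp)
qed

lemma ptime_Pair:
  assumes "ptime f" "ptime g"
  shows "ptime (\<lambda>v. Pair (f v) (g v))"
proof -
  obtain Q i j k p q r where *: "\<And>M. length M = 1 \<Longrightarrow>
      computes (M @ Q) i f p \<and> computes (M @ Q) j g q \<and> computes (M @ Q) k f r"
    using ptime_link[OF assms(1,2,1), of 1] by blast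
  obtain b c where b: "\<And>v. sexp_size (f v) \<le> poly b (sexp_size v)"
    and c: "\<And>v. sexp_size (g v) \<le> poly c (sexp_size v)"
    using ptime_size[OF assms(1)] ptime_size[OF assms(2)] by blast
  define P where "P = [PairE (Call i [Arg 0]) (Call j [Arg 0])] @ Q"
  have P: "computes P i f p" "computes P j g q" using *[of "[_]"] by (simp_all add: P_def)
  show ?thesis
  proof (rule ptimeI)
    fix v
    obtain t where t: "t \<le> poly p (sexp_size v) + 2" "eval P [v] (Call i [Arg 0]) (f v) t"
      using computes_call_arg[OF P(1)] by blast
    obtain s where s: "s \<le> poly q (sexp_size v) + 2" "eval P [v] (Call j [Arg 0]) (g v) s"
      using computes_call_arg[OF P(2)] by blast
    have "t + s + sexp_size (Pair (f v) (g v)) \<le> poly (p + q + b + c + [:5:]) (sexp_size v)"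
      using t(1) s(1) b[of v] c[of v] by simp
    then show "\<exists>t \<le> poly (p + q + b + c + [:5:]) (sexp_size v).
        eval P [v] (P ! 0) (Pair (f v) (g v)) t"
      using eval_Pair[OF t(2) s(2)] by (auto simp: P_def simp del: poly_add)
  qed (simp add: P_def)
qed

lemma ptime_if:
  assumes "pdec c" "ptime f" "ptime g"
  shows "ptime (\<lambda>v. if c v then f v else g v)"
proof -
  obtain Q i j k r p q where *: "\<And>M. length M = 1 \<Longrightarrow>
      computes (M @ Q) i (\<lambda>v. enc_bool (c v)) r \<and> computes (M @ Q) j f p \<and> computes (M @ Q) k g q"
    using ptime_link[OF assms[unfolded pdec_def], of 1] by blast
  define P where "P = [IfE (Call i [Arg 0]) (Call j [Arg 0]) (Call k [Arg 0])] @ Q"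
  have P: "computes P i (\<lambda>v. enc_bool (c v)) r" "computes P j f p" "computes P k g q"
    using *[of "[_]"] by (auto simp: P_def)
  show ?thesis
  proof (rule ptimeI)
    fix v
    obtain a where a: "a \<le> poly r (sexp_size v) + 2"
        "eval P [v] (Call i [Arg 0]) (enc_bool (c v)) a"
      using computes_call_arg[OF P(1)] by blast
    obtain t where t: "t \<le> poly p (sexp_size v) + 2" "eval P [v] (Call j [Arg 0]) (f v) t"
      using computes_call_arg[OF P(2)] by blast
    obtain s where s: "s \<le> poly q (sexp_size v) + 2" "eval P [v] (Call k [Arg 0]) (g v) s"
      using computes_call_arg[OF P(3)] by blast
    show "\<exists>t \<le> poly (p + q + r + [:5:]) (sexp_size v).
        eval P [v] (P ! 0) (if c v then f v else g v) t"
    proof (cases "c v")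
      case True
      then show ?thesis
        using eval_If_true[OF a(2) _ t(2)] a(1) t(1)
        by (intro exI[of _ "a + t + 1"]) (auto simp: P_def enc_bool_def)
    next
      case False
      then show ?thesis
        using eval_If_false[of P "[v]" _ a _ "g v" s] a s
        by (intro exI[of _ "a + s + 1"]) (auto simp: P_def enc_bool_def)
    qed
  qed (simp add: P_def)
qed

text \<open>Function 0 computes the initial state, and function 1 is the loop as a tail call to
  itself. Polynomially many rounds of a polynomial step may still produce exponential states, so the
  hypothesis bounds all intermediate states too.\<close>

lemma ptime_while:
  assumes "pdec c" "ptime s" "ptime h"
    and loop: "\<And>v. \<exists>k \<le> poly p (sexp_size v). f v = (s ^^ k) (h v) \<and>
      (\<forall>i<k. c ((s ^^ i) (h v))) \<and> \<not> c ((s ^^ k) (h v)) \<and>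
      (\<forall>i\<le>k. sexp_size ((s ^^ i) (h v)) \<le> poly r (sexp_size v))"
  shows "ptime f"
proof -
  obtain Q i j k a b d where *: "\<And>M. length M = 2 \<Longrightarrow>
      computes (M @ Q) i (\<lambda>v. enc_bool (c v)) a \<and> computes (M @ Q) j s b \<and> computes (M @ Q) k h d"
    using ptime_link[OF assms(1-3)[unfolded pdec_def], of 2] by blast
  define N where "N = IfE (Call i [Arg 0]) (Call 1 [Call j [Arg 0]]) (Arg 0)"
  define P where "P = [Call 1 [Call k [Arg 0]], N] @ Q"
  have P: "computes P i (\<lambda>v. enc_bool (c v)) a" "computes P j s b" "computes P k h d"
    and P1: "P ! 0 = Call 1 [Call k [Arg 0]]" "P ! 1 = N" "1 < length P"
    using *[of "[_, _]"] by (auto simp: P_def)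
  \<comment> \<open>The summand 10 covers the constant costs of a round: argument lookups, calls and
    the conditional.\<close>
  have iter: "\<exists>t \<le> Suc k * (poly a B + poly b B + 10). eval P [w] N ((s ^^ k) w) t"
    if "\<And>i. i < k \<Longrightarrow> c ((s ^^ i) w)" "\<not> c ((s ^^ k) w)"
      "\<And>i. i \<le> k \<Longrightarrow> sexp_size ((s ^^ i) w) \<le> B" for k w B
    using that
  proof (induction k arbitrary: w)
    case 0
    obtain x where x: "x \<le> poly a (sexp_size w) + 2"
        "eval P [w] (Call i [Arg 0]) (enc_bool (c w)) x"
      using computes_call_arg[OF P(1)] by blast
    have "eval P [w] N w (x + 1 + 1)"
      unfolding N_def using 0(2) x(2) eval_Arg[of 0 "[w]" P]
      by (intro eval_If_false) (auto simp: enc_bool_def)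
    moreover have "poly a (sexp_size w) \<le> poly a B"
      using 0(3)[of 0] by (intro poly_nat_mono) auto
    ultimately show ?case using x(1) by (intro exI[of _ "x + 1 + 1"]) auto
  next
    case (Suc k)
    obtain x where x: "x \<le> poly a (sexp_size w) + 2"
        "eval P [w] (Call i [Arg 0]) (enc_bool (c w)) x"
      using computes_call_arg[OF P(1)] by blast
    obtain y where y: "y \<le> poly b (sexp_size w) + 2" "eval P [w] (Call j [Arg 0]) (s w) y"
      using computes_call_arg[OF P(2)] by blast
    have "\<exists>t \<le> Suc k * (poly a B + poly b B + 10). eval P [s w] N ((s ^^ k) (s w)) t"
    proof (rule Suc.IH)
      show "c ((s ^^ i) (s w))" if "i < k" for i
        using Suc.prems(1)[of "Suc i"] that by (simp add: funpow_swap1)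
      show "\<not> c ((s ^^ k) (s w))"
        using Suc.prems(2) by (simp add: funpow_swap1)
      show "sexp_size ((s ^^ i) (s w)) \<le> B" if "i \<le> k" for i
        using Suc.prems(3)[of "Suc i"] that by (simp add: funpow_swap1)
    qed
    then obtain z where z: "z \<le> Suc k * (poly a B + poly b B + 10)"
        "eval P [s w] (P ! 1) ((s ^^ Suc k) w) z"
      by (auto simp: P1(2) funpow_swap1 simp del: One_nat_def)
    have "evals P [w] [Call j [Arg 0]] [s w] (y + 0)"
      by (intro evals_Cons evals_Nil y(2))
    then have "eval P [w] (Call 1 [Call j [Arg 0]]) ((s ^^ Suc k) w) (y + 0 + z + 1)"
      using P1(3) z(2) by (rule eval_Call)
    then have "eval P [w] N ((s ^^ Suc k) w) (x + (y + 0 + z + 1) + 1)"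
      unfolding N_def using x(2) Suc.prems(1)[of 0] by (intro eval_If_true) (auto simp: enc_bool_def)
    moreover have "poly a (sexp_size w) \<le> poly a B" "poly b (sexp_size w) \<le> poly b B"
      using Suc.prems(3)[of 0] by (auto intro!: poly_nat_mono)
    ultimately show ?case using x(1) y(1) z(1)
      by (intro exI[of _ "x + (y + 0 + z + 1) + 1"]) (auto simp: algebra_simps)
  qed
  define q where "q = d + [:5:] + (p + 1) * (pcompose a r + pcompose b r + [:10:])"
  show ?thesis
  proof (rule ptimeI)
    fix v
    obtain k' where k: "k' \<le> poly p (sexp_size v)" "f v = (s ^^ k') (h v)"
        "\<And>i. i < k' \<Longrightarrow> c ((s ^^ i) (h v))" "\<not> c ((s ^^ k') (h v))"
        "\<And>i. i \<le> k' \<Longrightarrow> sexp_size ((s ^^ i) (h v)) \<le> poly r (sexp_size v)"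
      using loop[of v] by blast
    let ?B = "poly r (sexp_size v)"
    obtain t where t: "t \<le> Suc k' * (poly a ?B + poly b ?B + 10)" "eval P [h v] (P ! 1) (f v) t"
      using iter[OF k(3-5)] by (auto simp: k(2) P1(2) simp del: One_nat_def)
    obtain u where u: "u \<le> poly d (sexp_size v) + 2" "eval P [v] (Call k [Arg 0]) (h v) u"
      using computes_call_arg[OF P(3)] by blast
    have "evals P [v] [Call k [Arg 0]] [h v] (u + 0)"
      by (intro evals_Cons evals_Nil u(2))
    then have "eval P [v] (P ! 0) (f v) (u + 0 + t + 1)"
      unfolding P1(1) using P1(3) t(2) by (rule eval_Call)
    moreover have "u + 0 + t + 1 \<le> poly q (sexp_size v)"
    proof -
      have "t \<le> Suc (poly p (sexp_size v)) * (poly a ?B + poly b ?B + 10)"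
        using t(1) k(1) by (meson Suc_le_mono mult_le_mono1 order_trans)
      moreover have "poly q (sexp_size v) = poly d (sexp_size v) + 5 +
          Suc (poly p (sexp_size v)) * (poly a ?B + poly b ?B + 10)"
        by (simp add: q_def poly_pcompose)
      ultimately show ?thesis using u(1) by linarith
    qed
    ultimately show "\<exists>t \<le> poly q (sexp_size v). eval P [v] (P ! 0) (f v) t" by blast
  qed (simp add: P_def)
qed

lemma pdec_nonAtom:
  assumes "ptime f"
  shows "pdec (\<lambda>v. f v \<noteq> Atom)"
proof -
  have "ptime (\<lambda>v. enc_bool (v \<noteq> Atom))"
  proof (rule ptimeI)
    fix v
    let ?P = "[IfE (Arg 0) (PairE AtomE AtomE) AtomE]"
    have a: "eval ?P [v] (Arg 0) v 1"
      using eval_Arg[of 0 "[v]"] by simp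
    show "\<exists>t \<le> poly [:10:] (sexp_size v). eval ?P [v] (?P ! 0) (enc_bool (v \<noteq> Atom)) t"
    proof (cases "v = Atom")
      case True
      then show ?thesis
        using eval_If_false[of ?P "[v]", OF _ eval_Atom] a
        by (intro exI[of _ "1 + 1 + 1"]) (auto simp: enc_bool_def)
    next
      case False
      then show ?thesis
        using eval_If_true[OF a _ eval_Pair[OF eval_Atom eval_Atom]]
        by (intro exI[of _ "1 + (1 + 1 + sexp_size (Pair Atom Atom)) + 1"]) (auto simp: enc_bool_def)
    qed
  qed simp
  then show ?thesis
    unfolding pdec_def using assms by (rule ptime_comp)
qed

lemma pdec_not:
  assumes "pdec c"
  shows "pdec (\<lambda>v. \<not> c v)"
proof -
  have "enc_bool (\<not> c v) = (if c v then Atom else Pair Atom Atom)" for v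
    by (simp add: enc_bool_def)
  then show ?thesis
    using ptime_if[OF assms ptime_Atom ptime_Pair[OF ptime_Atom ptime_Atom]] by (simp add: pdec_def)
qed

lemma pdec_conj:
  assumes "pdec c" "pdec d"
  shows "pdec (\<lambda>v. c v \<and> d v)"
proof -
  have "enc_bool (c v \<and> d v) = (if c v then enc_bool (d v) else Atom)" for v
    by (simp add: enc_bool_def)
  then show ?thesis
    using ptime_if[OF assms(1) assms(2)[unfolded pdec_def] ptime_Atom] by (simp add: pdec_def)
qed

lemma pdec_disj:
  assumes "pdec c" "pdec d"
  shows "pdec (\<lambda>v. c v \<or> d v)"
  using pdec_not[OF pdec_conj[OF pdec_not[OF assms(1)] pdec_not[OF assms(2)]]] by simp

lemma pdec_comp:
  assumes "pdec c" "ptime f"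
  shows "pdec (\<lambda>v. c (f v))"
  using ptime_comp[OF assms(1)[unfolded pdec_def] assms(2)] by (simp add: pdec_def)

lemma pdec_is_Atom:
  assumes "ptime f"
  shows "pdec (\<lambda>v. f v = Atom)"
  using pdec_not[OF pdec_nonAtom[OF assms]] by simp

section \<open>Lists of S-expressions: folds, maps, filters and bounded quantifiers\<close>

primrec slist :: "sexp \<Rightarrow> sexp list" where
  "slist Atom = []"
| "slist (Pair a b) = a # slist b"

text \<open>Every S-expression encodes exactly one list, so list operations make sense on all
  inputs.\<close>

lemma enc_list_slist [simp]: "enc_list (slist v) = v"
  by (induction v) auto

lemma slist_enc_list [simp]: "slist (enc_list vs) = vs"
  by (induction vs) auto

lemma slist_eq_Nil_iff [simp]: "slist v = [] \<longleftrightarrow> v = Atom"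
  by (cases v) auto

lemma enc_list_eq_Atom_iff [simp]: "enc_list vs = Atom \<longleftrightarrow> vs = []"
  by (cases vs) auto

lemma sexp_size_pos [simp]: "0 < sexp_size v"
  by (cases v) auto

lemma sexp_size_enc_list_append:
  "sexp_size (enc_list (xs @ ys)) + 1 = sexp_size (enc_list xs) + sexp_size (enc_list ys)"
  by (induction xs) auto

lemma size_member_slist: "x \<in> set (slist v) \<Longrightarrow> sexp_size x < sexp_size v"
  by (induction v) auto

lemma length_slist: "length (slist v) < sexp_size v"
  by (induction v) auto

lemma sexp_size_enc_list_le:
  assumes "\<forall>x \<in> set xs. sexp_size x \<le> B"
  shows "sexp_size (enc_list xs) \<le> length xs * (B + 1) + 1"
  using assms by (induction xs) auto

lemma sexp_size_sfst: "sexp_size (sfst v) \<le> sexp_size v"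
  by (cases v) auto

lemma sexp_size_ssnd: "sexp_size (ssnd v) \<le> sexp_size v"
  by (cases v) auto

text \<open>The loop state holds the rest of the list, the parameter \<open>v\<close> and the
  accumulator. A prefix \<open>xs\<close> stands for an intermediate moment, so the bound on
  prefixes bounds every state.\<close>

lemma ptime_fold:
  assumes h: "ptime (\<lambda>w. h (sfst w) (sfst (ssnd w)) (ssnd (ssnd w)))" and "ptime g" "ptime i"
    and bound: "\<And>v xs ys. slist (g v) = xs @ ys \<Longrightarrow>
      sexp_size (fold (h v) xs (i v)) \<le> poly r (sexp_size v)"
  shows "ptime (\<lambda>v. fold (h v) (slist (g v)) (i v))"
proof -
  let ?c = "\<lambda>w. sfst w \<noteq> Atom"
  let ?s = "\<lambda>w. Pair (ssnd (sfst w)) (Pair (sfst (ssnd w))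
    (h (sfst (ssnd w)) (sfst (sfst w)) (ssnd (ssnd w))))"
  let ?h = "\<lambda>v. Pair (g v) (Pair v (i v))"
  have iter: "(?s ^^ k) (Pair (enc_list xs) (Pair v a)) =
      Pair (enc_list (drop k xs)) (Pair v (fold (h v) (take k xs) a))" if "k \<le> length xs" for k xs v a
    using that
  proof (induction k arbitrary: xs a)
    case (Suc k)
    then obtain y ys where "xs = y # ys" by (cases xs) auto
    with Suc show ?case by (simp add: funpow_Suc_right del: funpow.simps(2))
  qed simp
  have "ptime (\<lambda>w. h (sfst (ssnd w)) (sfst (sfst w)) (ssnd (ssnd w)))"
    using ptime_comp[OF h, of "\<lambda>w. Pair (sfst (ssnd w)) (Pair (sfst (sfst w)) (ssnd (ssnd w)))"]
    by (simp add: ptime_Pair ptime_sfst ptime_ssnd ptime_id)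
  then have s: "ptime ?s"
    by (intro ptime_Pair ptime_sfst ptime_ssnd ptime_id)
  obtain b where b: "\<And>v. sexp_size (g v) \<le> poly b (sexp_size v)"
    using ptime_size[OF \<open>ptime g\<close>] by blast
  \<comment> \<open>The loop ends in a full state with an empty list; the accumulator is projected
    out afterwards.\<close>
  have "ptime (\<lambda>v. Pair Atom (Pair v (fold (h v) (slist (g v)) (i v))))"
  proof (rule ptime_while[where c = ?c and s = ?s and h = ?h and p = b and
        r = "b + [:0, 1:] + r + [:2:]"])
    show "pdec ?c" by (intro pdec_nonAtom ptime_sfst ptime_id)
    show "ptime ?h" by (intro ptime_Pair ptime_id assms)
    fix v
    let ?xs = "slist (g v)"
    have it: "(?s ^^ k) (?h v) = Pair (enc_list (drop k ?xs)) (Pair v (fold (h v) (take k ?xs) (i v)))"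
      if "k \<le> length ?xs" for k
      using iter[OF that] by simp
    have "length ?xs \<le> poly b (sexp_size v)"
      using length_slist[of "g v"] b[of v] by linarith
    moreover have "sexp_size ((?s ^^ k) (?h v)) \<le> poly (b + [:0, 1:] + r + [:2:]) (sexp_size v)"
      if "k \<le> length ?xs" for k
    proof -
      have "sexp_size (enc_list (drop k ?xs)) \<le> sexp_size (enc_list ?xs)"
        using sexp_size_enc_list_append[of "take k ?xs" "drop k ?xs"]
          sexp_size_pos[of "enc_list (take k ?xs)"] by (simp del: sexp_size_pos)
      then show ?thesis
        using b[of v] bound[of v "take k ?xs" "drop k ?xs"] unfolding it[OF that] by simp
    qed
    ultimately show "\<exists>k \<le> poly b (sexp_size v).
        Pair Atom (Pair v (fold (h v) ?xs (i v))) = (?s ^^ k) (?h v) \<and>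
        (\<forall>i<k. ?c ((?s ^^ i) (?h v))) \<and> \<not> ?c ((?s ^^ k) (?h v)) \<and>
        (\<forall>i\<le>k. sexp_size ((?s ^^ i) (?h v)) \<le> poly (b + [:0, 1:] + r + [:2:]) (sexp_size v))"
      by (intro exI[of _ "length ?xs"] conjI allI impI) (simp_all add: it del: funpow.simps)
  qed (rule s)
  from ptime_ssnd[OF ptime_ssnd[OF this]] show ?thesis by simp
qed

lemma ptime_rev:
  assumes "ptime g"
  shows "ptime (\<lambda>v. enc_list (rev (slist (g v))))"
proof -
  obtain b where b: "\<And>v. sexp_size (g v) \<le> poly b (sexp_size v)"
    using ptime_size[OF assms] by blast
  have *: "fold Pair xs (enc_list ys) = enc_list (rev xs @ ys)" for xs ys
    by (induction xs arbitrary: ys) (simp_all flip: enc_list.simps)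
  have size_rev: "sexp_size (enc_list (rev xs)) = sexp_size (enc_list xs)" for xs
  proof (induction xs)
    case (Cons a xs)
    then show ?case using sexp_size_enc_list_append[of "rev xs" "[a]"] by simp
  qed simp
  have "ptime (\<lambda>v. fold (\<lambda>x s. Pair x s) (slist (g v)) Atom)"
  proof (rule ptime_fold[where r = b])
    fix v xs ys
    assume "slist (g v) = xs @ ys"
    then have "sexp_size (enc_list xs) \<le> sexp_size (enc_list (slist (g v)))"
      using sexp_size_enc_list_append[of xs ys] sexp_size_pos[of "enc_list ys"]
      by (simp del: sexp_size_pos enc_list_slist)
    with b[of v] *[of xs "[]"] size_rev[of xs]
    show "sexp_size (fold (\<lambda>x s. Pair x s) xs Atom) \<le> poly b (sexp_size v)" by simp
  qed (intro ptime_Pair ptime_sfst ptime_ssnd ptime_id ptime_Atom assms)+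
  with *[of _ "[]"] show ?thesis by simp
qed

lemma ptime_foldr:
  assumes h: "ptime (\<lambda>w. h (sfst w) (sfst (ssnd w)) (ssnd (ssnd w)))" and "ptime g" "ptime i"
    and bound: "\<And>v xs ys. slist (g v) = xs @ ys \<Longrightarrow>
      sexp_size (foldr (h v) ys (i v)) \<le> poly r (sexp_size v)"
  shows "ptime (\<lambda>v. foldr (h v) (slist (g v)) (i v))"
proof -
  have "ptime (\<lambda>v. fold (h v) (slist (enc_list (rev (slist (g v))))) (i v))"
  proof (rule ptime_fold[where r = r])
    fix v xs ys
    assume "slist (enc_list (rev (slist (g v)))) = xs @ ys"
    then have "rev (rev (slist (g v))) = rev (xs @ ys)" by simp
    then have "slist (g v) = rev ys @ rev xs" by simp
    from bound[OF this] show "sexp_size (fold (h v) xs (i v)) \<le> poly r (sexp_size v)"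
      by (simp add: foldr_conv_fold)
  qed (intro h ptime_rev assms)+
  then show ?thesis by (simp add: foldr_conv_fold)
qed

lemma ptime_map:
  assumes f: "ptime (\<lambda>w. f (sfst w) (ssnd w))" and g: "ptime g"
  shows "ptime (\<lambda>v. enc_list (map (f v) (slist (g v))))"
proof -
  obtain a where a: "\<And>v x. sexp_size (f v x) \<le> poly a (sexp_size v + sexp_size x + 1)"
    using ptime_size[OF f] by (metis sfst.simps(2) ssnd.simps(2) sexp_size.simps(2) Suc_eq_plus1)
  obtain b where b: "\<And>v. sexp_size (g v) \<le> poly b (sexp_size v)"
    using ptime_size[OF g] by blast
  define r where "r = b * (pcompose a ([:0, 1:] + b + [:1:]) + [:1:]) + [:1:]"
  have *: "foldr (\<lambda>x s. Pair (f v x) s) xs Atom = enc_list (map (f v) xs)" for v xs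
    by (induction xs) auto
  have "ptime (\<lambda>w. f (sfst w) (sfst (ssnd w)))"
    using ptime_comp[OF f, of "\<lambda>w. Pair (sfst w) (sfst (ssnd w))"]
    by (simp add: ptime_Pair ptime_sfst ptime_ssnd ptime_id)
  then have "ptime (\<lambda>v. foldr (\<lambda>x s. Pair (f v x) s) (slist (g v)) Atom)"
  proof (intro ptime_foldr[where r = r] ptime_Pair ptime_sfst ptime_ssnd ptime_id ptime_Atom g)
    fix v xs ys
    assume xs: "slist (g v) = xs @ ys"
    let ?B = "poly a (sexp_size v + poly b (sexp_size v) + 1)"
    have "sexp_size (enc_list (map (f v) ys)) \<le> length (map (f v) ys) * (?B + 1) + 1"
    proof (rule sexp_size_enc_list_le, safe)
      fix y assume "y \<in> set (map (f v) ys)"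
      then obtain x where x: "x \<in> set ys" "y = f v x" by auto
      then have "sexp_size x \<le> poly b (sexp_size v)"
        using size_member_slist[of x "g v"] b[of v] xs by simp
      then have "poly a (sexp_size v + sexp_size x + 1) \<le> ?B"
        by (intro poly_nat_mono) simp
      then show "sexp_size y \<le> ?B"
        using a[of v x] x(2) by simp
    qed
    also have "\<dots> \<le> poly b (sexp_size v) * (?B + 1) + 1"
    proof -
      have "length (map (f v) ys) \<le> poly b (sexp_size v)"
        using length_slist[of "g v"] b[of v] xs by simp
      then show ?thesis by (intro add_mono mult_le_mono) auto
    qed
    finally show "sexp_size (foldr (\<lambda>x s. Pair (f v x) s) ys Atom) \<le> poly r (sexp_size v)"
      by (simp add: * r_def poly_pcompose ac_simps)
  qed
  then show ?thesis by (simp add: *)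
qed

text \<open>Since \<open>h\<close> can only add the current element, keep the list or empty it, the
  result never outgrows the scanned part. Filtering and \<open>takeWhile\<close> are both of this
  kind.\<close>

lemma ptime_sublist:
  assumes h: "ptime (\<lambda>w. enc_list (h (sfst w) (sfst (ssnd w)) (slist (ssnd (ssnd w)))))"
    and g: "ptime g"
    and grow: "\<And>v x s. h v x s = x # s \<or> h v x s = s \<or> h v x s = []"
  shows "ptime (\<lambda>v. enc_list (foldr (h v) (slist (g v)) []))"
proof -
  obtain b where b: "\<And>v. sexp_size (g v) \<le> poly b (sexp_size v)"
    using ptime_size[OF g] by blast
  have *: "foldr (\<lambda>x s. enc_list (h v x (slist s))) xs Atom = enc_list (foldr (h v) xs [])" for v xs
    by (induction xs) auto
  have size: "sexp_size (enc_list (foldr (h v) xs [])) \<le> sexp_size (enc_list xs)" for v xs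
  proof (induction xs)
    case (Cons x xs)
    then show ?case using grow[of v x "foldr (h v) xs []"] by auto
  qed simp
  have "ptime (\<lambda>v. foldr (\<lambda>x s. enc_list (h v x (slist s))) (slist (g v)) Atom)"
  proof (rule ptime_foldr[where r = b])
    fix v xs ys
    assume "slist (g v) = xs @ ys"
    then have "sexp_size (enc_list ys) \<le> sexp_size (enc_list (slist (g v)))"
      using sexp_size_enc_list_append[of xs ys] sexp_size_pos[of "enc_list xs"]
      by (simp del: sexp_size_pos enc_list_slist)
    with b[of v] size[of v ys]
    show "sexp_size (foldr (\<lambda>x s. enc_list (h v x (slist s))) ys Atom) \<le> poly b (sexp_size v)"
      by (simp add: *)
  qed (intro h g ptime_Atom)+
  then show ?thesis by (simp add: *)
qed

lemma ptime_filter: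
  assumes c: "pdec (\<lambda>w. c (sfst w) (ssnd w))" and g: "ptime g"
  shows "ptime (\<lambda>v. enc_list (filter (c v) (slist (g v))))"
proof -
  have "filter (c v) xs = foldr (\<lambda>x s. if c v x then x # s else s) xs []" for v xs
    by (induction xs) auto
  moreover have "pdec (\<lambda>w. c (sfst w) (sfst (ssnd w)))"
    using pdec_comp[OF c, of "\<lambda>w. Pair (sfst w) (sfst (ssnd w))"]
    by (simp add: ptime_Pair ptime_sfst ptime_ssnd ptime_id)
  then have "ptime (\<lambda>w. if c (sfst w) (sfst (ssnd w)) then Pair (sfst (ssnd w)) (ssnd (ssnd w))
      else ssnd (ssnd w))"
    by (intro ptime_if ptime_Pair ptime_sfst ptime_ssnd ptime_id)
  then have "ptime (\<lambda>w. enc_list (if c (sfst w) (sfst (ssnd w))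
      then sfst (ssnd w) # slist (ssnd (ssnd w)) else slist (ssnd (ssnd w))))"
    by (simp add: if_distrib cong: if_cong)
  then have "ptime (\<lambda>v. enc_list (foldr (\<lambda>x s. if c v x then x # s else s) (slist (g v)) []))"
    using g by (rule ptime_sublist) auto
  ultimately show ?thesis by simp
qed

lemma ptime_takeWhile:
  assumes c: "pdec (\<lambda>w. c (sfst w) (ssnd w))" and g: "ptime g"
  shows "ptime (\<lambda>v. enc_list (takeWhile (c v) (slist (g v))))"
proof -
  have "takeWhile (c v) xs = foldr (\<lambda>x s. if c v x then x # s else []) xs []" for v xs
    by (induction xs) auto
  moreover have "pdec (\<lambda>w. c (sfst w) (sfst (ssnd w)))"
    using pdec_comp[OF c, of "\<lambda>w. Pair (sfst w) (sfst (ssnd w))"]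
    by (simp add: ptime_Pair ptime_sfst ptime_ssnd ptime_id)
  then have "ptime (\<lambda>w. if c (sfst w) (sfst (ssnd w)) then Pair (sfst (ssnd w)) (ssnd (ssnd w))
      else Atom)"
    by (intro ptime_if ptime_Pair ptime_sfst ptime_ssnd ptime_id ptime_Atom)
  then have "ptime (\<lambda>w. enc_list (if c (sfst w) (sfst (ssnd w))
      then sfst (ssnd w) # slist (ssnd (ssnd w)) else []))"
    by (simp add: if_distrib cong: if_cong)
  then have "ptime (\<lambda>v. enc_list (foldr (\<lambda>x s. if c v x then x # s else []) (slist (g v)) []))"
    using g by (rule ptime_sublist) auto
  ultimately show ?thesis by simp
qed

lemma pdec_Bex:
  assumes c: "pdec (\<lambda>w. c (sfst w) (ssnd w))" and g: "ptime g"
  shows "pdec (\<lambda>v. \<exists>x \<in> set (slist (g v)). c v x)"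
  using pdec_nonAtom[OF ptime_filter[OF assms]] by (simp add: filter_empty_conv)

lemma pdec_Ball:
  assumes c: "pdec (\<lambda>w. c (sfst w) (ssnd w))" and g: "ptime g"
  shows "pdec (\<lambda>v. \<forall>x \<in> set (slist (g v)). c v x)"
  using pdec_not[OF pdec_Bex[OF pdec_not[OF c] g]] by simp

section \<open>Loops controlled by a measure, and equality of S-expressions\<close>

lemma while_funpow:
  assumes "\<not> b ((c ^^ k) s)"
  shows "while b c s = (c ^^ (LEAST k. \<not> b ((c ^^ k) s))) s"
  using assms by (auto simp: while_def while_option_def)

text \<open>A measure linear in the state bounds the number of rounds, and growth by a constant per
  round then bounds every state. Both conditions concern arbitrary states that satisfy the guard,
  not only reachable ones.\<close>

lemma ptime_while_measure:
  fixes \<mu> :: "sexp \<Rightarrow> nat"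
  assumes "pdec c" "ptime s" "ptime h"
    and dec: "\<And>w. c w \<Longrightarrow> \<mu> (s w) < \<mu> w"
    and \<mu>: "\<And>w. \<mu> w \<le> m * sexp_size w"
    and grow: "\<And>w. c w \<Longrightarrow> sexp_size (s w) \<le> sexp_size w + g"
  shows "ptime (\<lambda>v. while c s (h v))"
proof -
  obtain b where b: "\<And>v. sexp_size (h v) \<le> poly b (sexp_size v)"
    using ptime_size[OF assms(3)] by blast
  show ?thesis
  proof (rule ptime_while[where p = "[:m:] * b" and r = "b + [:m:] * b * [:g:]", OF assms(1-3)])
    fix v
    let ?x = "h v"
    have run: "\<mu> ((s ^^ i) ?x) + i \<le> \<mu> ?x \<and> sexp_size ((s ^^ i) ?x) \<le> sexp_size ?x + i * g"
      if "\<forall>j<i. c ((s ^^ j) ?x)" for i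
      using that
    proof (induction i)
      case (Suc i)
      then show ?case using dec[of "(s ^^ i) ?x"] grow[of "(s ^^ i) ?x"] by fastforce
    qed simp
    have ex: "\<exists>k. \<not> c ((s ^^ k) ?x)"
    proof (rule ccontr)
      assume "\<nexists>k. \<not> c ((s ^^ k) ?x)"
      with run[of "Suc (\<mu> ?x)"] show False by auto
    qed
    define k where "k = (LEAST k. \<not> c ((s ^^ k) ?x))"
    have k: "\<not> c ((s ^^ k) ?x)" "\<forall>i<k. c ((s ^^ i) ?x)"
      using ex LeastI_ex[of "\<lambda>k. \<not> c ((s ^^ k) ?x)"] not_less_Least
      unfolding k_def by blast+
    have kb: "k \<le> m * poly b (sexp_size v)"
      using run[OF k(2)] \<mu>[of ?x] mult_le_mono2[OF b[of v], of m] by linarith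
    have "sexp_size ((s ^^ i) ?x) \<le> poly (b + [:m:] * b * [:g:]) (sexp_size v)" if "i \<le> k" for i
    proof -
      have "\<forall>j<i. c ((s ^^ j) ?x)" using k(2) that by auto
      then have "sexp_size ((s ^^ i) ?x) \<le> sexp_size ?x + i * g" using run by blast
      also have "\<dots> \<le> poly b (sexp_size v) + m * poly b (sexp_size v) * g"
        using kb that b[of v] by (intro add_mono mult_le_mono) auto
      finally show ?thesis by (simp add: ac_simps)
    qed
    with k kb while_funpow[of c k s ?x]
    show "\<exists>k \<le> poly ([:m:] * b) (sexp_size v). while c s ?x = (s ^^ k) ?x \<and>
        (\<forall>i<k. c ((s ^^ i) ?x)) \<and> \<not> c ((s ^^ k) ?x) \<and>
        (\<forall>i\<le>k. sexp_size ((s ^^ i) ?x) \<le> poly (b + [:m:] * b * [:g:]) (sexp_size v))"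
      by (intro exI[of _ k]) (simp add: k_def)
  qed
qed

text \<open>The plain size of a stack does not fall when its top \<open>Pair a b\<close> is replaced
  by the two entries \<open>a\<close> and \<open>b\<close>, because the extra list cell costs as
  much as the pair did. Adding up the entries without the list cells gives a quantity that does
  fall.\<close>

definition weight :: "sexp \<Rightarrow> nat" where
  "weight v = (\<Sum>x\<leftarrow>slist v. 2 * sexp_size x)"

lemma weight_simps [simp]: "weight Atom = 0" "weight (Pair a b) = 2 * sexp_size a + weight b"
  by (simp_all add: weight_def)

lemma weight_le: "weight v \<le> 2 * sexp_size v"
  by (induction v) (auto simp: weight_def)

text \<open>The state of the equality test is a pair of stacks of subterms. They are equal if and only
  if the two original terms are.\<close>

definition eq_step :: "sexp \<Rightarrow> sexp" where
  "eq_step w =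
    (if sfst (sfst w) = Atom \<and> sfst (ssnd w) = Atom then
       (if ssnd w = Atom then Pair Atom (Pair Atom Atom) else Pair (ssnd (sfst w)) (ssnd (ssnd w)))
     else if sfst (sfst w) \<noteq> Atom \<and> sfst (ssnd w) \<noteq> Atom then
       Pair (Pair (sfst (sfst (sfst w))) (Pair (ssnd (sfst (sfst w))) (ssnd (sfst w))))
         (Pair (sfst (sfst (ssnd w))) (Pair (ssnd (sfst (ssnd w))) (ssnd (ssnd w))))
     else Pair Atom (Pair Atom Atom))"

text \<open>A mismatch leads to the fixed state \<open>Pair Atom (Pair Atom Atom)\<close>, which
  stops the loop with different components. This includes an exhausted second stack, which
  \<open>sfst\<close> alone cannot tell from one with \<open>Atom\<close> on top.\<close>

lemma eq_step:
  assumes "sfst w \<noteq> Atom"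
  shows "weight (sfst (eq_step w)) < weight (sfst w)"
    and "sexp_size (eq_step w) \<le> sexp_size w + 5"
    and "sfst (eq_step w) = ssnd (eq_step w) \<longleftrightarrow> sfst w = ssnd w"
proof -
  obtain a as bs where w: "w = Pair (Pair a as) bs"
    using assms by (cases w; cases "sfst w") auto
  show "weight (sfst (eq_step w)) < weight (sfst w)"
    by (cases a; cases bs; cases "sfst bs") (auto simp: w eq_step_def)
  show "sexp_size (eq_step w) \<le> sexp_size w + 5"
    by (cases a; cases bs; cases "sfst bs") (auto simp: w eq_step_def)
  show "sfst (eq_step w) = ssnd (eq_step w) \<longleftrightarrow> sfst w = ssnd w"
    by (cases a; cases bs; cases "sfst bs") (auto simp: w eq_step_def)
qed

text \<open>The language can only test for \<open>Atom\<close>. When the loop stops, the first stack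
  is empty, so the original terms agree exactly if the second is empty too.\<close>

lemma pdec_eq:
  assumes "ptime f" "ptime g"
  shows "pdec (\<lambda>v. f v = g v)"
proof -
  let ?c = "\<lambda>w. sfst w \<noteq> Atom"
  let ?h = "\<lambda>v. Pair (Pair (f v) Atom) (Pair (g v) Atom)"
  let ?r = "\<lambda>v. while ?c eq_step (?h v)"
  have "ptime eq_step"
    unfolding eq_step_def[abs_def]
    by (intro ptime_if pdec_conj pdec_is_Atom pdec_nonAtom ptime_Pair ptime_sfst ptime_ssnd
        ptime_id ptime_Atom)
  then have "ptime ?r"
  proof (rule ptime_while_measure[where \<mu> = "\<lambda>w. weight (sfst w)" and m = 2 and g = 5, rotated])
    show "weight (sfst w) \<le> 2 * sexp_size w" for w
      using weight_le[of "sfst w"] sexp_size_sfst[of w] by linarith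
  qed (use eq_step in \<open>auto intro!: pdec_nonAtom ptime_Pair ptime_sfst ptime_id ptime_Atom assms\<close>)
  moreover have "f v = g v \<longleftrightarrow> ssnd (?r v) = Atom" for v
  proof -
    have "(f v = g v \<longleftrightarrow> sfst (?r v) = ssnd (?r v)) \<and> sfst (?r v) = Atom"
      by (rule while_rule[where P = "\<lambda>w. f v = g v \<longleftrightarrow> sfst w = ssnd w"
            and r = "Wellfounded.measure (\<lambda>w. weight (sfst w))"])
        (auto simp: eq_step)
    then show ?thesis by auto
  qed
  ultimately show ?thesis
    by (simp add: pdec_is_Atom ptime_ssnd)
qed

text \<open>The growth is additive, by an amount that depends only on the parameter
  \<open>v\<close>. Such steps can be iterated polynomially often, whereas a step that doubles the
  state cannot.\<close>

definition growing :: "(sexp \<Rightarrow> sexp \<Rightarrow> sexp) \<Rightarrow> bool" where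
  "growing h \<longleftrightarrow> ptime (\<lambda>w. h (sfst w) (ssnd w)) \<and>
     (\<exists>q. \<forall>v s. sexp_size (h v s) \<le> sexp_size s + poly q (sexp_size v))"

lemma growing_comp:
  assumes "growing h" "growing k"
  shows "growing (\<lambda>v s. h v (k v s))"
proof -
  obtain p q where p: "\<And>v s. sexp_size (h v s) \<le> sexp_size s + poly p (sexp_size v)"
    and q: "\<And>v s. sexp_size (k v s) \<le> sexp_size s + poly q (sexp_size v)"
    using assms by (auto simp: growing_def)
  have "sexp_size (h v (k v s)) \<le> sexp_size s + poly (p + q) (sexp_size v)" for v s
    using p[of v "k v s"] q[of v s] by simp
  moreover have "ptime (\<lambda>w. h (sfst w) (k (sfst w) (ssnd w)))"
    using ptime_comp[of "\<lambda>w. h (sfst w) (ssnd w)" "\<lambda>w. Pair (sfst w) (k (sfst w) (ssnd w))"] assms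
    by (simp add: growing_def ptime_Pair ptime_sfst ptime_id)
  ultimately show ?thesis unfolding growing_def by blast
qed

lemma fold_const: "fold (\<lambda>_. f) xs s = (f ^^ length xs) s"
  by (induction xs arbitrary: s) (auto simp: funpow_swap1)

text \<open>Loop counts are expressed by the length of the parameter, so nesting this lemma yields
  powers of that length.\<close>

lemma growing_funpow_length:
  assumes "growing h"
  shows "growing (\<lambda>v. h v ^^ length (slist v))"
proof -
  obtain q where q: "\<And>v s. sexp_size (h v s) \<le> sexp_size s + poly q (sexp_size v)"
    using assms by (auto simp: growing_def)
  have size: "sexp_size ((h v ^^ n) s) \<le> sexp_size s + n * poly q (sexp_size v)" for v s n
  proof (induction n)
    case (Suc n)
    then show ?case using q[of v "(h v ^^ n) s"] by simp
  qed simp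
  have size': "sexp_size ((h v ^^ n) s) \<le> sexp_size s + sexp_size v * poly q (sexp_size v)"
    if "n \<le> length (slist v)" for v s n
  proof -
    have "n * poly q (sexp_size v) \<le> sexp_size v * poly q (sexp_size v)"
      using that length_slist[of v] by (intro mult_le_mono1) simp
    then show ?thesis using size[where v = v and n = n and s = s] by linarith
  qed
  have "ptime (\<lambda>w. fold (\<lambda>_. h (sfst w)) (slist (sfst w)) (ssnd w))"
  proof (rule ptime_fold[where r = "[:0, 1:] + [:0, 1:] * q"])
    show "ptime (\<lambda>w. h (sfst (sfst w)) (ssnd (ssnd w)))"
      using ptime_comp[of "\<lambda>w. h (sfst w) (ssnd w)" "\<lambda>w. Pair (sfst (sfst w)) (ssnd (ssnd w))"] assms
      by (simp add: growing_def ptime_Pair ptime_sfst ptime_ssnd ptime_id)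
  next
    fix w xs ys
    assume "slist (sfst w) = xs @ ys"
    then have "length xs \<le> length (slist (sfst w))" by simp
    from size'[OF this, of "ssnd w"]
    have "sexp_size ((h (sfst w) ^^ length xs) (ssnd w))
        \<le> sexp_size (ssnd w) + sexp_size (sfst w) * poly q (sexp_size (sfst w))" .
    also have "\<dots> \<le> sexp_size w + sexp_size w * poly q (sexp_size w)"
      by (intro add_mono mult_le_mono poly_nat_mono sexp_size_sfst sexp_size_ssnd)
    finally show "sexp_size (fold (\<lambda>_. h (sfst w)) xs (ssnd w))
        \<le> poly ([:0, 1:] + [:0, 1:] * q) (sexp_size w)"
      by (simp add: fold_const)
  qed (intro ptime_sfst ptime_ssnd ptime_id)+
  then show ?thesis
    unfolding growing_def fold_const using size' by (auto intro!: exI[of _ "[:0, 1:] * q"])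
qed

section \<open>Substitution into functions of several arguments\<close>

lemma ptime_lift2:
  assumes "ptime (\<lambda>w. h (sfst w) (ssnd w))" "ptime f" "ptime g"
  shows "ptime (\<lambda>v. h (f v) (g v))"
  using ptime_comp[OF assms(1) ptime_Pair[OF assms(2,3)]] by simp

lemma pdec_lift2:
  assumes "pdec (\<lambda>w. c (sfst w) (ssnd w))" "ptime f" "ptime g"
  shows "pdec (\<lambda>v. c (f v) (g v))"
  using pdec_comp[OF assms(1) ptime_Pair[OF assms(2,3)]] by simp

lemma pdec_lift4:
  assumes "pdec (\<lambda>w. c (sfst w) (sfst (ssnd w)) (sfst (ssnd (ssnd w))) (ssnd (ssnd (ssnd w))))"
    "ptime f" "ptime g" "ptime k" "ptime l"
  shows "pdec (\<lambda>v. c (f v) (g v) (k v) (l v))"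
  using pdec_comp[OF assms(1) ptime_Pair[OF assms(2) ptime_Pair[OF assms(3)
    ptime_Pair[OF assms(4,5)]]]] by simp

lemma ptime_lift4:
  assumes "ptime (\<lambda>w. h (sfst w) (sfst (ssnd w)) (sfst (ssnd (ssnd w))) (ssnd (ssnd (ssnd w))))"
    "ptime f" "ptime g" "ptime k" "ptime l"
  shows "ptime (\<lambda>v. h (f v) (g v) (k v) (l v))"
  using ptime_comp[OF assms(1) ptime_Pair[OF assms(2) ptime_Pair[OF assms(3)
    ptime_Pair[OF assms(4,5)]]]] by simp

lemmas ptime_basic = ptime_id ptime_Atom ptime_sfst ptime_ssnd ptime_Pair ptime_if
  pdec_not pdec_conj pdec_disj pdec_eq

lemma pdec_member:
  assumes "ptime f" "ptime g"
  shows "pdec (\<lambda>v. f v \<in> set (slist (g v)))"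
proof -
  have "pdec (\<lambda>w. \<exists>x \<in> set (slist (ssnd w)). x = sfst w)"
    by (intro pdec_Bex ptime_basic)
  then have "pdec (\<lambda>w. sfst w \<in> set (slist (ssnd w)))" by simp
  from pdec_lift2[OF this assms] show ?thesis .
qed

section \<open>Saturation\<close>

text \<open>Encoded dag nodes, encoded tree nodes and the lines of the saturated list share one
  layout: \<open>Pair Atom c\<close>, or \<open>Pair p (Pair x c)\<close> with \<open>p\<close>
  different from \<open>Atom\<close>. Only the meaning of \<open>p\<close> varies, so one accessor
  serves all three.\<close>

definition label :: "sexp \<Rightarrow> sexp" where
  "label t = (if sfst t = Atom then ssnd t else ssnd (ssnd t))"

definition pivot :: "sexp \<Rightarrow> sexp" where
  "pivot t = sfst (ssnd t)"

definition pos_lit :: "sexp \<Rightarrow> sexp" where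
  "pos_lit x = Pair (Pair Atom Atom) x"

definition neg_lit :: "sexp \<Rightarrow> sexp" where
  "neg_lit x = Pair Atom x"

definition subsumes :: "sexp \<Rightarrow> sexp \<Rightarrow> bool" where
  "subsumes c d \<longleftrightarrow> (\<forall>l \<in> set (slist c). l \<in> set (slist d))"

definition resolves_into :: "sexp \<Rightarrow> sexp \<Rightarrow> sexp \<Rightarrow> sexp \<Rightarrow> bool" where
  "resolves_into x a b c \<longleftrightarrow>
     pos_lit x \<in> set (slist a) \<and> neg_lit x \<in> set (slist b) \<and>
     (\<forall>l \<in> set (slist a). l = pos_lit x \<or> l \<in> set (slist c)) \<and>
     (\<forall>l \<in> set (slist b). l = neg_lit x \<or> l \<in> set (slist c))"

text \<open>If \<open>a\<close> and \<open>b\<close> resolve into a subclause of \<open>c\<close>, this is that subclause. Cutting it out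
  of \<open>c\<close> keeps clauses duplicate free and no longer than \<open>c\<close>.\<close>

definition cut_out :: "sexp \<Rightarrow> sexp \<Rightarrow> sexp \<Rightarrow> sexp \<Rightarrow> sexp" where
  "cut_out x a b c = enc_list (filter (\<lambda>l. l \<in> set (slist a) \<and> l \<noteq> pos_lit x \<or>
     l \<in> set (slist b) \<and> l \<noteq> neg_lit x) (slist c))"

definition covered :: "sexp \<Rightarrow> sexp \<Rightarrow> bool" where
  "covered L t \<longleftrightarrow> (\<exists>d \<in> set (slist L). subsumes (label d) (label t))"

text \<open>Lists of candidates for the two premises; the heads are used.\<close>

definition parent0 :: "sexp \<Rightarrow> sexp \<Rightarrow> sexp" where
  "parent0 t L = enc_list (filter (\<lambda>d. \<exists>e \<in> set (slist L).
     resolves_into (pivot t) (label d) (label e) (label t)) (slist L))"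

definition parent1 :: "sexp \<Rightarrow> sexp \<Rightarrow> sexp" where
  "parent1 t L = enc_list (filter (\<lambda>e.
     resolves_into (pivot t) (label (sfst (parent0 t L))) (label e) (label t)) (slist L))"

text \<open>An element of the list \<open>L\<close>, newest first, is \<open>Pair Atom c\<close> for an initial clause \<open>c\<close>, or
  \<open>Pair (Pair a b) (Pair x c)\<close> for a resolvent \<open>c\<close> on \<open>x\<close> of the earlier clauses \<open>a\<close> and \<open>b\<close>.\<close>

definition update :: "sexp \<Rightarrow> sexp \<Rightarrow> sexp" where
  "update t L =
    (if covered L t then L
     else if sfst t = Atom then Pair t L
     else if parent0 t L = Atom then L
     else Pair (Pair (Pair (label (sfst (parent0 t L))) (label (sfst (parent1 t L))))
       (Pair (pivot t) (cut_out (pivot t) (label (sfst (parent0 t L))) (label (sfst (parent1 t L)))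
         (label t)))) L)"

definition saturate :: "sexp \<Rightarrow> sexp" where
  "saturate ts = fold (\<lambda>_. fold update (slist ts)) (slist ts) Atom"

section \<open>Running time of saturation\<close>

lemma ptime_label: "ptime f \<Longrightarrow> ptime (\<lambda>v. label (f v))"
  unfolding label_def by (intro ptime_basic)

lemma ptime_pivot: "ptime f \<Longrightarrow> ptime (\<lambda>v. pivot (f v))"
  unfolding pivot_def by (intro ptime_basic)

lemma ptime_pos_lit: "ptime f \<Longrightarrow> ptime (\<lambda>v. pos_lit (f v))"
  unfolding pos_lit_def by (intro ptime_basic)

lemma ptime_neg_lit: "ptime f \<Longrightarrow> ptime (\<lambda>v. neg_lit (f v))"
  unfolding neg_lit_def by (intro ptime_basic)

lemmas ptime_clause = ptime_basic pdec_member pdec_Bex pdec_Ball ptime_filter ptime_label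
  ptime_pivot ptime_pos_lit ptime_neg_lit

lemma pdec_subsumes:
  assumes "ptime f" "ptime g"
  shows "pdec (\<lambda>v. subsumes (f v) (g v))"
proof -
  have "pdec (\<lambda>w. subsumes (sfst w) (ssnd w))"
    unfolding subsumes_def by (intro ptime_clause)
  from pdec_lift2[OF this assms] show ?thesis .
qed

lemma pdec_resolves_into:
  assumes "ptime x" "ptime f" "ptime g" "ptime h"
  shows "pdec (\<lambda>v. resolves_into (x v) (f v) (g v) (h v))"
proof -
  have "pdec (\<lambda>w. resolves_into (sfst w) (sfst (ssnd w)) (sfst (ssnd (ssnd w))) (ssnd (ssnd (ssnd w))))"
    unfolding resolves_into_def by (intro ptime_clause)
  from pdec_lift4[OF this assms] show ?thesis .
qed

lemma ptime_cut_out: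
  assumes "ptime x" "ptime f" "ptime g" "ptime h"
  shows "ptime (\<lambda>v. cut_out (x v) (f v) (g v) (h v))"
proof -
  have "ptime (\<lambda>w. cut_out (sfst w) (sfst (ssnd w)) (sfst (ssnd (ssnd w))) (ssnd (ssnd (ssnd w))))"
    unfolding cut_out_def by (intro ptime_clause)
  from ptime_lift4[OF this assms] show ?thesis .
qed

lemma ptime_parent0:
  assumes "ptime f" "ptime g"
  shows "ptime (\<lambda>v. parent0 (f v) (g v))"
proof -
  have "ptime (\<lambda>w. parent0 (sfst w) (ssnd w))"
    unfolding parent0_def by (intro ptime_clause pdec_resolves_into)
  from ptime_lift2[OF this assms] show ?thesis .
qed

lemma ptime_parent1:
  assumes "ptime f" "ptime g"
  shows "ptime (\<lambda>v. parent1 (f v) (g v))"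
proof -
  have "ptime (\<lambda>w. parent1 (sfst w) (ssnd w))"
    unfolding parent1_def by (intro ptime_clause pdec_resolves_into ptime_parent0)
  from ptime_lift2[OF this assms] show ?thesis .
qed

lemma ptime_update:
  assumes "ptime f" "ptime g"
  shows "ptime (\<lambda>v. update (f v) (g v))"
proof -
  have "ptime (\<lambda>w. update (sfst w) (ssnd w))"
    unfolding update_def covered_def
    by (intro ptime_clause pdec_subsumes ptime_cut_out ptime_parent0 ptime_parent1)
  from ptime_lift2[OF this assms] show ?thesis .
qed

lemma sexp_size_label: "sexp_size (label t) \<le> sexp_size t"
  unfolding label_def using sexp_size_ssnd[of t] sexp_size_ssnd[of "ssnd t"] by auto

lemma sexp_size_filter: "sexp_size (enc_list (filter P xs)) \<le> sexp_size (enc_list xs)"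
  by (induction xs) auto

lemma sfst_in_slist: "v \<noteq> Atom \<Longrightarrow> sfst v \<in> set (slist v)"
  by (cases v) auto

text \<open>A line qualifies for \<open>parent0\<close> only if it has a partner in the list, so the
  candidates in \<open>parent1\<close> for its head cannot be empty.\<close>

lemma parents:
  assumes "parent0 t L \<noteq> Atom"
  shows "sfst (parent0 t L) \<in> set (slist L)" "sfst (parent1 t L) \<in> set (slist L)"
    and "resolves_into (pivot t) (label (sfst (parent0 t L))) (label (sfst (parent1 t L))) (label t)"
proof -
  have *: "sfst (parent0 t L) \<in> set (slist L) \<and> (\<exists>e \<in> set (slist L).
      resolves_into (pivot t) (label (sfst (parent0 t L))) (label e) (label t))"
    using sfst_in_slist[OF assms] by (auto simp: parent0_def)
  then have "parent1 t L \<noteq> Atom"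
    by (auto simp: parent1_def filter_empty_conv)
  from sfst_in_slist[OF this]
  have "sfst (parent1 t L) \<in> set (slist L) \<and>
      resolves_into (pivot t) (label (sfst (parent0 t L))) (label (sfst (parent1 t L))) (label t)"
    by (subst (asm) (2) parent1_def) simp
  with * show "sfst (parent0 t L) \<in> set (slist L)" "sfst (parent1 t L) \<in> set (slist L)"
    and "resolves_into (pivot t) (label (sfst (parent0 t L))) (label (sfst (parent1 t L))) (label t)"
    by blast+
qed

definition labels_le :: "nat \<Rightarrow> sexp \<Rightarrow> bool" where
  "labels_le B L \<longleftrightarrow> (\<forall>l \<in> set (slist L). sexp_size (label l) \<le> B)"

text \<open>A new line copies two earlier clauses, which might compound over time. It does not,
  because its own clause is cut out of the clause of \<open>t\<close>: all labels stay within a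
  fixed \<open>B\<close>, and an update adds a constant number of pieces of that size.\<close>

lemma update_size:
  assumes "labels_le B L" "sexp_size t \<le> B"
  shows "labels_le B (update t L) \<and> sexp_size (update t L) \<le> sexp_size L + (5 * B + 10)"
proof (cases "covered L t \<or> sfst t = Atom \<or> parent0 t L = Atom")
  case True
  then show ?thesis
    using assms sexp_size_label[of t] by (auto simp: update_def labels_le_def)
next
  case False
  define d e where "d = label (sfst (parent0 t L))" and "e = label (sfst (parent1 t L))"
  have "sexp_size d \<le> B" "sexp_size e \<le> B"
    using parents[of t L] False assms(1) by (auto simp: d_def e_def labels_le_def)
  moreover have "sexp_size (pivot t) \<le> B"
    using sexp_size_sfst[of "ssnd t"] sexp_size_ssnd[of t] assms(2) by (simp add: pivot_def)
  moreover have "sexp_size (cut_out (pivot t) d e (label t)) \<le> B"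
  proof -
    have "sexp_size (cut_out (pivot t) d e (label t)) \<le> sexp_size (label t)"
      unfolding cut_out_def by (rule order_trans[OF sexp_size_filter]) simp
    then show ?thesis using sexp_size_label[of t] assms(2) by linarith
  qed
  moreover have "update t L = Pair (Pair (Pair d e) (Pair (pivot t) (cut_out (pivot t) d e (label t)))) L"
    using False by (simp add: update_def d_def e_def)
  moreover have "label (Pair (Pair d e) (Pair (pivot t) (cut_out (pivot t) d e (label t)))) =
      cut_out (pivot t) d e (label t)"
    by (simp add: label_def)
  ultimately show ?thesis
    using assms(1) by (simp add: labels_le_def)
qed

lemma fold_update_size:
  assumes "labels_le B L" "\<forall>t \<in> set ts. sexp_size t \<le> B"
  shows "labels_le B (fold update ts L) \<and>
    sexp_size (fold update ts L) \<le> sexp_size L + length ts * (5 * B + 10)"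
  using assms
proof (induction ts arbitrary: L)
  case (Cons t ts)
  then show ?case using update_size[of B L t] by fastforce
qed simp

lemma ptime_saturate:
  assumes "ptime f"
  shows "ptime (\<lambda>v. saturate (f v))"
proof -
  have ts: "\<forall>t \<in> set xs. sexp_size t \<le> B" if "slist v = xs @ ys" "sexp_size v \<le> B" for xs ys v B
    using that size_member_slist[of _ v] by fastforce
  have pass: "ptime (\<lambda>w. fold update (slist (sfst w)) (ssnd w))"
  proof (rule ptime_fold[where r = "[:0, 1:] + [:0, 1:] * [:10, 5:]"])
    show "ptime (\<lambda>w. update (sfst (ssnd w)) (ssnd (ssnd w)))"
      by (intro ptime_update ptime_basic)
  next
    fix w xs ys
    assume w: "slist (sfst w) = xs @ ys"
    \<comment> \<open>The accumulated list is arbitrary here, so its labels are bounded by the size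
      of the whole argument.\<close>
    have "\<forall>l \<in> set (slist (ssnd w)). sexp_size (label l) \<le> sexp_size w"
      using size_member_slist[of _ "ssnd w"] sexp_size_ssnd[of w] sexp_size_label
      by (meson le_trans less_imp_le)
    then have "sexp_size (fold update xs (ssnd w)) \<le>
        sexp_size (ssnd w) + length xs * (5 * sexp_size w + 10)"
      using fold_update_size[of "sexp_size w" "ssnd w" xs] ts[OF w sexp_size_sfst]
      by (simp add: labels_le_def)
    also have "\<dots> \<le> sexp_size w + sexp_size w * (5 * sexp_size w + 10)"
      using arg_cong[OF w, of length] length_slist[of "sfst w"] sexp_size_sfst[of w]
      by (intro add_mono mult_le_mono1 sexp_size_ssnd) simp
    finally show "sexp_size (fold update xs (ssnd w))
        \<le> poly ([:0, 1:] + [:0, 1:] * [:10, 5:]) (sexp_size w)"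
      by (simp add: algebra_simps)
  qed (intro ptime_basic)+
  have "ptime (\<lambda>v. fold (\<lambda>_. fold update (slist v)) (slist v) Atom)"
  proof (rule ptime_fold[where r = "[:0, 1:] * ([:0, 1:] * [:10, 5:]) + [:1:]"])
    show "ptime (\<lambda>w. fold update (slist (sfst w)) (ssnd (ssnd w)))"
      using ptime_comp[OF pass, of "\<lambda>w. Pair (sfst w) (ssnd (ssnd w))"]
      by (simp add: ptime_basic)
  next
    fix v xs ys
    assume v: "slist v = xs @ ys"
    have "labels_le (sexp_size v) (fold (\<lambda>_. fold update (slist v)) xs L) \<and>
        sexp_size (fold (\<lambda>_. fold update (slist v)) xs L) \<le>
        sexp_size L + length xs * (length (slist v) * (5 * sexp_size v + 10))"
      if "labels_le (sexp_size v) L" for L and xs :: "sexp list"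
      using that
    proof (induction xs arbitrary: L)
      case (Cons x xs)
      then show ?case
        using fold_update_size[of "sexp_size v" L "slist v"] ts[of v "slist v" "[]"] by fastforce
    qed simp
    from this[of Atom xs]
    have "sexp_size (fold (\<lambda>_. fold update (slist v)) xs Atom) \<le>
        1 + length xs * (length (slist v) * (5 * sexp_size v + 10))"
      by (simp add: labels_le_def)
    also have "\<dots> \<le> 1 + sexp_size v * (sexp_size v * (5 * sexp_size v + 10))"
      using arg_cong[OF v, of length] length_slist[of v]
      by (intro add_mono mult_le_mono order_refl) auto
    finally show "sexp_size (fold (\<lambda>_. fold update (slist v)) xs Atom)
        \<le> poly ([:0, 1:] * ([:0, 1:] * [:10, 5:]) + [:1:]) (sexp_size v)"
      by (simp add: ac_simps)
  qed (intro ptime_basic)+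
  from ptime_comp[OF this assms] show ?thesis
    by (simp add: saturate_def)
qed

section \<open>Postorder listing of an encoded tree\<close>

text \<open>The output list grows at its front and the right subtree is on top of the left one, so the
  output is the postorder of the tree.\<close>

definition flat_step :: "sexp \<Rightarrow> sexp" where
  "flat_step w =
    (if sfst (sfst (sfst w)) = Atom then Pair (ssnd (sfst w)) (Pair (sfst (sfst w)) (ssnd w))
     else Pair
       (Pair (ssnd (sfst (sfst (sfst w)))) (Pair (sfst (sfst (sfst (sfst w)))) (ssnd (sfst w))))
       (Pair (Pair (Pair Atom Atom) (ssnd (sfst (sfst w)))) (ssnd w)))"

definition flatten :: "sexp \<Rightarrow> sexp" where
  "flatten v = ssnd (while (\<lambda>w. sfst w \<noteq> Atom) flat_step (Pair (Pair v Atom) Atom))"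

lemma flat_step:
  assumes "sfst w \<noteq> Atom"
  shows "weight (sfst (flat_step w)) < weight (sfst w)"
    and "sexp_size (flat_step w) \<le> sexp_size w + 10"
proof -
  obtain t ts out where w: "w = Pair (Pair t ts) out"
    using assms by (cases w; cases "sfst w") auto
  show "weight (sfst (flat_step w)) < weight (sfst w)"
    by (cases t; cases "sfst t") (auto simp: w flat_step_def)
  show "sexp_size (flat_step w) \<le> sexp_size w + 10"
    by (cases t; cases "sfst t") (auto simp: w flat_step_def)
qed

lemma ptime_flatten:
  assumes "ptime f"
  shows "ptime (\<lambda>v. flatten (f v))"
  unfolding flatten_def
proof (intro ptime_ssnd ptime_while_measure[where \<mu> = "\<lambda>w. weight (sfst w)" and m = 2 and g = 10])
  show "ptime flat_step"
    unfolding flat_step_def[abs_def] by (intro ptime_basic)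
  show "weight (sfst w) \<le> 2 * sexp_size w" for w
    using weight_le[of "sfst w"] sexp_size_sfst[of w] by linarith
qed (use flat_step in \<open>auto intro!: pdec_nonAtom ptime_basic assms\<close>)

definition items :: "sexp \<Rightarrow> sexp" where
  "items v = (if sfst v = Atom then ssnd v else flatten (ssnd v))"

lemma ptime_items: "ptime items"
  unfolding items_def[abs_def] by (intro ptime_basic ptime_flatten)

section \<open>Extracting a dag\<close>

definition needed :: "sexp \<Rightarrow> sexp \<Rightarrow> bool" where
  "needed l out \<longleftrightarrow> label l = Atom \<or>
     (\<exists>k \<in> set (slist out). label l = sfst (sfst k) \<or> label l = ssnd (sfst k))"

text \<open>Unneeded lines would become further sinks. The list is newest first, so every possible
  user of a line has been decided before the line itself, and the kept lines come out oldest
  first.\<close>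

definition prune :: "sexp \<Rightarrow> sexp" where
  "prune L = fold (\<lambda>l out. if needed l out then Pair l out else out) (slist L) Atom"

text \<open>A list of atoms is a unary numeral, so the prefix before the first line labelled
  \<open>a\<close> turns into the position of that line when its entries are replaced by
  \<open>Atom\<close>.\<close>

definition pointer :: "sexp \<Rightarrow> sexp \<Rightarrow> sexp" where
  "pointer a L = enc_list (map (\<lambda>_. Atom) (takeWhile (\<lambda>k. label k \<noteq> a) (slist L)))"

definition link :: "sexp \<Rightarrow> sexp \<Rightarrow> sexp" where
  "link L l = (if sfst l = Atom then l
     else Pair (Pair (pointer (sfst (sfst l)) L) (pointer (ssnd (sfst l)) L)) (ssnd l))"

definition dag_of :: "sexp \<Rightarrow> sexp" where
  "dag_of L = Pair Atom (enc_list (map (link (prune L)) (slist (prune L))))"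

lemma ptime_prune:
  assumes "ptime f"
  shows "ptime (\<lambda>v. prune (f v))"
proof -
  have "ptime (\<lambda>v. fold (\<lambda>l out. if needed l out then Pair l out else out) (slist v) Atom)"
  proof (rule ptime_fold[where r = "[:0, 1:]"])
    have "pdec (\<lambda>w. needed (sfst w) (ssnd w))"
      unfolding needed_def by (intro ptime_clause)
    from pdec_lift2[OF this, of "\<lambda>w. sfst (ssnd w)" "\<lambda>w. ssnd (ssnd w)"]
    have "pdec (\<lambda>w. needed (sfst (ssnd w)) (ssnd (ssnd w)))"
      by (simp add: ptime_basic)
    then show "ptime (\<lambda>w. if needed (sfst (ssnd w)) (ssnd (ssnd w))
        then Pair (sfst (ssnd w)) (ssnd (ssnd w)) else ssnd (ssnd w))"
      by (intro ptime_basic)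
  next
    fix v xs ys
    assume v: "slist v = xs @ ys"
    have "sexp_size (fold (\<lambda>l out. if needed l out then Pair l out else out) xs a) + 1
        \<le> sexp_size a + sexp_size (enc_list xs)" for xs a
    proof (induction xs arbitrary: a)
      case (Cons x xs)
      from Cons[of a] Cons[of "Pair x a"] show ?case by auto
    qed simp
    from this[of xs Atom]
    have "sexp_size (fold (\<lambda>l out. if needed l out then Pair l out else out) xs Atom)
        \<le> sexp_size (enc_list xs)" by simp
    also have "\<dots> \<le> sexp_size v"
      using sexp_size_enc_list_append[of xs ys] sexp_size_pos[of "enc_list ys"]
        enc_list_slist[of v, unfolded v] by (simp del: sexp_size_pos)
    finally show "sexp_size (fold (\<lambda>l out. if needed l out then Pair l out else out) xs Atom)
        \<le> poly [:0, 1:] (sexp_size v)" by simp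
  qed (intro ptime_basic)+
  from ptime_comp[OF this assms] show ?thesis by (simp add: prune_def)
qed

lemma ptime_pointer:
  assumes "ptime f" "ptime g"
  shows "ptime (\<lambda>v. pointer (f v) (g v))"
proof -
  have "ptime (\<lambda>w. enc_list (map (\<lambda>_. Atom)
      (slist (enc_list (takeWhile (\<lambda>k. label k \<noteq> sfst w) (slist (ssnd w)))))))"
    by (intro ptime_map ptime_takeWhile ptime_clause)
  from ptime_lift2[OF this[unfolded slist_enc_list] assms] show ?thesis
    unfolding pointer_def .
qed

lemma ptime_dag_of:
  assumes "ptime f"
  shows "ptime (\<lambda>v. dag_of (f v))"
proof -
  have "ptime (\<lambda>w. Pair Atom (enc_list (map (link w) (slist w))))"
    unfolding link_def by (intro ptime_map ptime_clause ptime_pointer)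
  from ptime_comp[OF this ptime_prune[OF assms]] show ?thesis
    unfolding dag_of_def .
qed

section \<open>Extracting a tree\<close>

definition lookup :: "sexp \<Rightarrow> sexp \<Rightarrow> sexp" where
  "lookup c L = sfst (enc_list (filter (\<lambda>l. label l = c) (slist L)))"

definition visit :: "sexp \<Rightarrow> sexp" where
  "visit c = Pair Atom c"

definition build :: "sexp \<Rightarrow> sexp" where
  "build c = Pair (Pair Atom Atom) c"

text \<open>A state \<open>Pair todo (Pair out learned)\<close> consists of the stack of pending commands, the stack
  of finished trees, and the list of clauses that may be used as lemmas.\<close>

definition search :: "sexp \<Rightarrow> sexp \<Rightarrow> sexp" where
  "search L s =
    (if sfst s = Atom then s
     else if sfst (sfst (sfst s)) = Atom then
       (if sfst (lookup (ssnd (sfst (sfst s))) L) = Atom \<or>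
           ssnd (sfst (sfst s)) \<in> set (slist (ssnd (ssnd s))) then
          Pair (ssnd (sfst s))
            (Pair (Pair (Pair Atom (ssnd (sfst (sfst s)))) (sfst (ssnd s))) (ssnd (ssnd s)))
        else
          Pair (Pair (visit (sfst (sfst (lookup (ssnd (sfst (sfst s))) L))))
              (Pair (visit (ssnd (sfst (lookup (ssnd (sfst (sfst s))) L))))
                (Pair (build (ssnd (sfst (sfst s)))) (ssnd (sfst s)))))
            (ssnd s))
     else
       Pair (ssnd (sfst s))
         (Pair (Pair (Pair (Pair (sfst (ssnd (sfst (ssnd s)))) (sfst (sfst (ssnd s))))
               (ssnd (lookup (ssnd (sfst (sfst s))) L)))
             (ssnd (ssnd (sfst (ssnd s)))))
           (if sfst (sfst (ssnd (sfst (ssnd s)))) = Atom \<and> sfst (sfst (sfst (ssnd s))) = Atom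
            then Pair (ssnd (sfst (sfst s))) (ssnd (ssnd s)) else ssnd (ssnd s))))"

text \<open>With \<open>n\<close> lines there are \<open>4 * n * n\<close> steps: the tree has at
  most about \<open>2 * n * n\<close> nodes, and each accounts for at most two steps. Surplus steps
  are harmless, because a state without pending commands is a fixed point.\<close>

definition tree_of :: "sexp \<Rightarrow> sexp" where
  "tree_of L = Pair (Pair Atom Atom) (sfst (sfst (ssnd
     ((((\<lambda>s. search L (search L (search L (search L s)))) ^^ length (slist L)) ^^ length (slist L))
       (Pair (Pair (visit Atom) Atom) (Pair Atom Atom))))))"

section \<open>Running time of the tree search\<close>

lemma ptime_lookup:
  assumes "ptime f" "ptime g"
  shows "ptime (\<lambda>v. lookup (f v) (g v))"
proof -
  have "ptime (\<lambda>w. lookup (sfst w) (ssnd w))"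
    unfolding lookup_def by (intro ptime_clause)
  from ptime_lift2[OF this assms] show ?thesis .
qed

lemma sexp_size_lookup: "sexp_size (lookup c L) \<le> sexp_size L"
proof -
  have "sexp_size (lookup c L) \<le> sexp_size (enc_list (filter (\<lambda>l. label l = c) (slist L)))"
    unfolding lookup_def by (rule sexp_size_sfst)
  also have "\<dots> \<le> sexp_size (enc_list (slist L))"
    by (rule sexp_size_filter)
  finally show ?thesis by simp
qed

text \<open>Finished trees are taken off the stack when they are joined, never copied, and the
  current command is consumed. Everything else that enters the state is part of a line of
  \<open>L\<close> or a constant number of cells.\<close>

lemma growing_search: "growing search"
  unfolding growing_def
proof
  show "ptime (\<lambda>w. search (sfst w) (ssnd w))"
    unfolding search_def visit_def build_def by (intro ptime_clause ptime_lookup)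
  have split: "sexp_size (sfst v) + sexp_size (ssnd v) \<le> sexp_size v + 1" for v
    by (cases v) auto
  have "sexp_size (search L s) \<le> sexp_size s + poly [:30, 5:] (sexp_size L)" for L s
  proof -
    define td out learned where s: "td = sfst s" "out = sfst (ssnd s)" "learned = ssnd (ssnd s)"
    define y l where y: "y = ssnd (sfst td)" "l = lookup y L"
    have "sexp_size td + sexp_size (ssnd s) \<le> sexp_size s + 1"
      "sexp_size out + sexp_size learned \<le> sexp_size (ssnd s) + 1"
      "sexp_size (sfst td) + sexp_size (ssnd td) \<le> sexp_size td + 1"
      "sexp_size y \<le> sexp_size (sfst td)"
      "sexp_size l \<le> sexp_size L" "sexp_size (ssnd l) \<le> sexp_size l"
      "sexp_size (sfst (sfst l)) + sexp_size (ssnd (sfst l)) \<le> sexp_size (sfst l) + 1"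
      "sexp_size (sfst l) \<le> sexp_size l"
      "sexp_size (sfst out) + sexp_size (ssnd out) \<le> sexp_size out + 1"
      "sexp_size (sfst (ssnd out)) + sexp_size (ssnd (ssnd out)) \<le> sexp_size (ssnd out) + 1"
      using split[of s] split[of "ssnd s"] split[of td] sexp_size_ssnd[of "sfst td"]
        sexp_size_lookup[of y L] sexp_size_ssnd[of l] split[of "sfst l"] sexp_size_sfst[of l]
        split[of out] split[of "ssnd out"]
      unfolding s y by simp_all
    then show ?thesis
      unfolding search_def s[symmetric] y[symmetric]
      by (auto simp: visit_def build_def)
  qed
  then show "\<exists>q. \<forall>v s. sexp_size (search v s) \<le> sexp_size s + poly q (sexp_size v)" by blast
qed

lemma ptime_tree_of:
  assumes "ptime f"
  shows "ptime (\<lambda>v. tree_of (f v))"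
proof -
  note search4 = growing_comp[OF growing_search growing_comp[OF growing_search
    growing_comp[OF growing_search growing_search]]]
  have "growing (\<lambda>L. ((\<lambda>s. search L (search L (search L (search L s)))) ^^ length (slist L))
      ^^ length (slist L))"
    by (rule growing_funpow_length[OF growing_funpow_length[OF search4]])
  then have "ptime (\<lambda>w. (((\<lambda>s. search (sfst w) (search (sfst w) (search (sfst w) (search (sfst w) s))))
      ^^ length (slist (sfst w))) ^^ length (slist (sfst w))) (ssnd w))"
    by (simp add: growing_def)
  note run = this
  have init: "ptime (\<lambda>L. Pair L (Pair (Pair (visit Atom) Atom) (Pair Atom Atom)))"
    unfolding visit_def by (intro ptime_basic)
  have "ptime (\<lambda>L.
      (((\<lambda>s. search L (search L (search L (search L s)))) ^^ length (slist L)) ^^ length (slist L))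
        (Pair (Pair (visit Atom) Atom) (Pair Atom Atom)))"
    using ptime_comp[OF run init] by simp
  then have "ptime (\<lambda>L. tree_of L)"
    unfolding tree_of_def by (intro ptime_Pair ptime_sfst ptime_ssnd ptime_Atom)
  from ptime_comp[OF this assms] show ?thesis .
qed

section \<open>Encodings\<close>

lemma enc_binary_inject [simp]: "enc_binary m = enc_binary n \<longleftrightarrow> m = n"
proof
  show "enc_binary m = enc_binary n \<Longrightarrow> m = n"
  proof (induction m arbitrary: n rule: less_induct)
    case (less m)
    show ?case
    proof (cases "m = 0 \<or> n = 0")
      case True
      then show ?thesis
        using less.prems by (auto simp: enc_binary.simps[of m] enc_binary.simps[of n] split: if_splits)
    next
      case False
      then have "enc_bool (odd m) = enc_bool (odd n)" "enc_binary (m div 2) = enc_binary (n div 2)"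
        using less.prems by (simp_all add: enc_binary.simps[of m] enc_binary.simps[of n])
      then have "odd m = odd n" "m div 2 = n div 2"
        using less.IH[of "m div 2"] False by (auto simp: enc_bool_def split: if_splits)
      then show ?thesis by (metis odd_two_times_div_two_succ even_two_times_div_two)
    qed
  qed
qed simp

lemma enc_literal_inject [simp]: "enc_literal l = enc_literal k \<longleftrightarrow> l = k"
  by (cases l; cases k) (auto simp: enc_bool_def)

lemma inj_enc_literal: "inj enc_literal"
  by (auto simp: inj_def)

lemma encodes_clause_iff:
  "encodes_clause C c \<longleftrightarrow> distinct (slist c) \<and> set (slist c) = enc_literal ` fset C"
proof
  assume "encodes_clause C c"
  then show "distinct (slist c) \<and> set (slist c) = enc_literal ` fset C"
    by (auto simp: encodes_clause_def distinct_map inj_on_def)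
next
  assume *: "distinct (slist c) \<and> set (slist c) = enc_literal ` fset C"
  then have "\<exists>ls. slist c = map enc_literal ls"
    by (auto simp: ex_map_conv)
  then obtain ls where ls: "slist c = map enc_literal ls" by blast
  then have "c = enc_list (map enc_literal ls)"
    by (metis enc_list_slist)
  moreover have "set ls = fset C"
    using * inj_image_eq_iff[OF inj_enc_literal] by (simp add: ls)
  ultimately show "encodes_clause C c"
    using * by (auto simp: encodes_clause_def ls distinct_map)
qed

lemma encodes_clause_unique: "encodes_clause C c \<Longrightarrow> encodes_clause D c \<Longrightarrow> C = D"
  using inj_image_eq_iff[OF inj_enc_literal] by (metis encodes_clause_iff fset_inject)

lemma encodes_clause_Atom [simp]: "encodes_clause C Atom \<longleftrightarrow> C = {||}"
  by (auto simp: encodes_clause_iff)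

lemma encodes_empty_clause [simp]: "encodes_clause {||} c \<longleftrightarrow> c = Atom"
  by (auto simp: encodes_clause_iff)

lemma member_encodes_clause:
  "encodes_clause C c \<Longrightarrow> enc_literal l \<in> set (slist c) \<longleftrightarrow> l |\<in>| C"
  by (auto simp: encodes_clause_iff)

lemma subsumes_encodes_clause:
  assumes "encodes_clause C c" "encodes_clause D d"
  shows "subsumes c d \<longleftrightarrow> C |\<subseteq>| D"
  using assms by (auto simp: subsumes_def encodes_clause_iff less_eq_fset.rep_eq)

lemma pos_lit_enc_binary: "pos_lit (enc_binary x) = enc_literal (Pos x)"
  by (simp add: pos_lit_def enc_bool_def)

lemma neg_lit_enc_binary: "neg_lit (enc_binary x) = enc_literal (Neg x)"
  by (simp add: neg_lit_def enc_bool_def)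

lemma resolves_into_encodes:
  assumes "encodes_clause A a" "encodes_clause B b" "encodes_clause C c"
  shows "resolves_into (enc_binary x) a b c \<longleftrightarrow>
    Pos x |\<in>| A \<and> Neg x |\<in>| B \<and> resolvent x A B |\<subseteq>| C"
proof -
  have "(\<forall>l \<in> set (slist a). l = enc_literal (Pos x) \<or> l \<in> set (slist c)) \<longleftrightarrow>
      A |-| {|Pos x|} |\<subseteq>| C"
    using assms(1,3) by (auto simp: encodes_clause_iff less_eq_fset.rep_eq simp del: enc_literal.simps)
  moreover have "(\<forall>l \<in> set (slist b). l = enc_literal (Neg x) \<or> l \<in> set (slist c)) \<longleftrightarrow>
      B |-| {|Neg x|} |\<subseteq>| C"
    using assms(2,3) by (auto simp: encodes_clause_iff less_eq_fset.rep_eq simp del: enc_literal.simps)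
  ultimately show ?thesis
    unfolding resolves_into_def pos_lit_enc_binary neg_lit_enc_binary resolvent_def
    using assms by (simp add: member_encodes_clause del: enc_literal.simps)
qed

lemma cut_out_encodes:
  assumes "encodes_clause A a" "encodes_clause B b" "encodes_clause C c"
    "resolvent x A B |\<subseteq>| C"
  shows "encodes_clause (resolvent x A B) (cut_out (enc_binary x) a b c)"
proof -
  have "set (slist (cut_out (enc_binary x) a b c)) =
      enc_literal ` {l. l |\<in>| C \<and> (l |\<in>| A \<and> l \<noteq> Pos x \<or> l |\<in>| B \<and> l \<noteq> Neg x)}"
    using assms(1-3) unfolding cut_out_def pos_lit_enc_binary neg_lit_enc_binary
    by (auto simp: encodes_clause_iff simp del: enc_literal.simps)
  also have "{l. l |\<in>| C \<and> (l |\<in>| A \<and> l \<noteq> Pos x \<or> l |\<in>| B \<and> l \<noteq> Neg x)} = fset (resolvent x A B)"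
    using assms(4) by (auto simp: resolvent_def)
  finally have "set (slist (cut_out (enc_binary x) a b c)) = enc_literal ` fset (resolvent x A B)" .
  moreover have "distinct (slist (cut_out (enc_binary x) a b c))"
    using assms(3) by (simp add: cut_out_def encodes_clause_iff)
  ultimately show ?thesis by (simp add: encodes_clause_iff)
qed

section \<open>Saturation eliminates weakening\<close>

text \<open>Premises are named by their encodings, and distinct labels make each name denote a
  unique line. The condition \<open>a \<noteq> b\<close> reflects that a dag node has two different
  predecessors.\<close>

inductive derivation :: "clause set \<Rightarrow> sexp list \<Rightarrow> bool" for F where
  Nil: "derivation F []"
| initial: "\<lbrakk>derivation F L; C \<in> F; encodes_clause C c; c \<notin> label ` set L\<rbrakk> \<Longrightarrow>
    derivation F (Pair Atom c # L)"
| inference: "\<lbrakk>derivation F L; a \<in> label ` set L; b \<in> label ` set L; a \<noteq> b;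
    encodes_clause A a; encodes_clause B b; encodes_clause C c; resolution x A B C;
    c \<notin> label ` set L\<rbrakk> \<Longrightarrow>
    derivation F (Pair (Pair a b) (Pair (enc_binary x) c) # L)"

lemma label_Pair [simp]: "label (Pair p c) = (if p = Atom then c else ssnd c)"
  by (simp add: label_def)

lemma pivot_Pair [simp]: "pivot (Pair p (Pair x c)) = x"
  by (simp add: pivot_def)

lemma derivation_distinct: "derivation F L \<Longrightarrow> distinct (map label L)"
  by (induction rule: derivation.induct) auto

lemma derivation_encodes: "derivation F L \<Longrightarrow> l \<in> set L \<Longrightarrow> \<exists>C. encodes_clause C (label l)"
  by (induction rule: derivation.induct) auto

definition covers :: "sexp \<Rightarrow> clause \<Rightarrow> bool" where
  "covers L C \<longleftrightarrow> (\<exists>d \<in> set (slist L). \<exists>D. encodes_clause D (label d) \<and> D |\<subseteq>| C)"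

text \<open>The common view of dag and tree nodes: \<open>None\<close> for a source or a leaf, the
  pivot otherwise. The content of \<open>p\<close> is left open, since it differs between dags and
  flattened trees.\<close>

fun encodes_item :: "var option \<times> clause \<Rightarrow> sexp \<Rightarrow> bool" where
  "encodes_item (None, C) t \<longleftrightarrow> (\<exists>c. encodes_clause C c \<and> t = Pair Atom c)"
| "encodes_item (Some x, C) t \<longleftrightarrow>
     (\<exists>p c. p \<noteq> Atom \<and> encodes_clause C c \<and> t = Pair p (Pair (enc_binary x) c))"

lemma encodes_item_label: "encodes_item i t \<Longrightarrow> encodes_clause (snd i) (label t)"
  by (cases "(i, t)" rule: encodes_item.cases) auto

lemma covered_iff_covers:
  assumes "derivation F (slist L)" "encodes_item i t"
  shows "covered L t \<longleftrightarrow> covers L (snd i)"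
  using derivation_encodes[OF assms(1)] subsumes_encodes_clause encodes_item_label[OF assms(2)]
  unfolding covered_def covers_def by metis

lemma subsumes_refl: "subsumes c c"
  by (simp add: subsumes_def)

lemma subsumes_cut_out: "subsumes (cut_out x a b c) c"
  by (simp add: subsumes_def cut_out_def)

lemma update_mono: "set (slist L) \<subseteq> set (slist (update t L))"
  by (auto simp: update_def)

lemma update_covered: "covered L t \<Longrightarrow> update t L = L"
  by (simp add: update_def)

lemma covered_mono: "set (slist L) \<subseteq> set (slist M) \<Longrightarrow> covered L t \<Longrightarrow> covered M t"
  by (auto simp: covered_def)

lemma covers_mono: "set (slist L) \<subseteq> set (slist M) \<Longrightarrow> covers L C \<Longrightarrow> covers M C"
  by (auto simp: covers_def)

lemma update_extends:
  assumes "encodes_item i t"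
  shows "update t L = L \<or> covered (update t L) t \<and> length (slist (update t L)) = Suc (length (slist L))"
proof (cases "(i, t)" rule: encodes_item.cases)
  case (1 C)
  then show ?thesis using assms subsumes_refl
    by (auto simp: update_def covered_def)
next
  case (2 x C)
  then show ?thesis using assms subsumes_cut_out
    by (auto simp: update_def covered_def)
qed

text \<open>A leaf used as a lemma looks like an initial clause, but if it is already covered then
  no line is added for it. For an inner item, whatever its premises were, only a genuine resolvent
  of listed clauses is recorded.\<close>

lemma update_derivation:
  assumes L: "derivation F (slist L)" and t: "encodes_item i t"
    and init: "fst i = None \<Longrightarrow> snd i \<in> F \<or> covers L (snd i)"
  shows "derivation F (slist (update t L))"
proof (cases "covered L t")
  case True
  then show ?thesis using L by (simp add: update_def)
next
  case False
  show ?thesis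
  proof (cases "(i, t)" rule: encodes_item.cases)
    case (1 C)
    then obtain c where c: "encodes_clause C c" "t = Pair Atom c" using t by auto
    have "C \<in> F"
      using init 1 False covered_iff_covers[OF L t] by auto
    moreover have "c \<notin> label ` set (slist L)"
      using False c(2) subsumes_refl by (auto simp: covered_def)
    ultimately show ?thesis
      using False c L by (auto simp: update_def intro: derivation.initial)
  next
    case (2 x C)
    then obtain p c where c: "p \<noteq> Atom" "encodes_clause C c" "t = Pair p (Pair (enc_binary x) c)"
      using t by auto
    show ?thesis
    proof (cases "parent0 t L = Atom")
      case True
      then show ?thesis using L c False by (simp add: update_def)
    next
      case p: False
      define a b where "a = label (sfst (parent0 t L))" and "b = label (sfst (parent1 t L))"
      note par = parents[OF p, folded a_def b_def]
      have ab: "a \<in> label ` set (slist L)" "b \<in> label ` set (slist L)"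
        using par(1,2) by (auto simp: a_def b_def)
      then obtain A B where AB: "encodes_clause A a" "encodes_clause B b"
        using derivation_encodes[OF L] by blast
      from par(3) have res: "Pos x |\<in>| A" "Neg x |\<in>| B" "resolvent x A B |\<subseteq>| C"
        using resolves_into_encodes[OF AB c(2)] c by auto
      \<comment> \<open>The resolvent of \<open>A\<close> with itself is \<open>A\<close>, as no
        literal is both \<open>Pos x\<close> and \<open>Neg x\<close>. So \<open>A\<close> would lie
        inside \<open>C\<close>, although \<open>C\<close> is not covered.\<close>
      have "a \<noteq> b"
      proof
        assume "a = b"
        then have "A = B" using AB encodes_clause_unique by blast
        with res(3) have "A |\<subseteq>| C"
          by (auto simp: resolvent_def)
        then have "subsumes a c" using AB(1) c(2) subsumes_encodes_clause by blast
        with False ab c show False by (auto simp: covered_def)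
      qed
      moreover have "cut_out (enc_binary x) a b c \<notin> label ` set (slist L)"
      proof
        assume "cut_out (enc_binary x) a b c \<in> label ` set (slist L)"
        then obtain d where "d \<in> set (slist L)" "label d = cut_out (enc_binary x) a b c" by auto
        then show False
          using False c subsumes_cut_out[of "enc_binary x" a b c] by (auto simp: covered_def)
      qed
      moreover have "encodes_clause (resolvent x A B) (cut_out (enc_binary x) a b c)"
        using cut_out_encodes[OF AB c(2) res(3)] .
      ultimately have "derivation F (Pair (Pair a b) (Pair (enc_binary x) (cut_out (enc_binary x) a b c))
          # slist L)"
        using L ab AB res(1,2) by (intro derivation.inference) (auto simp: resolution_def)
      then show ?thesis using False p c by (simp add: update_def a_def b_def)
    qed
  qed
qed

lemma covers_update_initial:
  assumes "derivation F (slist (update t L))" "encodes_item (None, C) t"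
  shows "covers (update t L) C"
proof -
  have "covered (update t L) t"
    using assms(2) subsumes_refl by (auto simp: update_def covered_def)
  then show ?thesis using covered_iff_covers[OF assms] by simp
qed

lemma covers_update_inference:
  assumes L: "derivation F (slist L)" and t: "encodes_item (Some x, C) t"
    and "covers L A" "covers L B" and inf: "inferred w_resolution x A B C"
  shows "covers (update t L) C"
proof (cases "covers L C")
  case True
  then show ?thesis using update_mono covers_mono by blast
next
  case False
  have L': "derivation F (slist (update t L))"
    using update_derivation[OF L t] by simp
  obtain p c where c: "p \<noteq> Atom" "encodes_clause C c" "t = Pair p (Pair (enc_binary x) c)"
    using t by auto
  \<comment> \<open>Since \<open>inferred\<close> leaves open which premise contributes the positive
    literal, the claim is made for arbitrary premises and used in both orders.\<close>
  have "parent0 t L \<noteq> Atom" if A: "covers L A" and B: "covers L B" and C: "C = resolvent x A B"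
    for A B
  proof -
    obtain d D where d: "d \<in> set (slist L)" "encodes_clause D (label d)" "D |\<subseteq>| A"
      using A by (auto simp: covers_def)
    obtain e E where e: "e \<in> set (slist L)" "encodes_clause E (label e)" "E |\<subseteq>| B"
      using B by (auto simp: covers_def)
    have "\<not> D |\<subseteq>| C" "\<not> E |\<subseteq>| C"
      using False d(1,2) e(1,2) by (auto simp: covers_def)
    then have "Pos x |\<in>| D" "Neg x |\<in>| E"
      using d(3) e(3) by (auto simp: C resolvent_def)
    moreover have "resolvent x D E |\<subseteq>| C"
      using d(3) e(3) by (auto simp: C resolvent_def)
    ultimately have "resolves_into (enc_binary x) (label d) (label e) c"
      using resolves_into_encodes[OF d(2) e(2) c(2)] by blast
    then show ?thesis
      using d(1) e(1) c by (auto simp: parent0_def filter_empty_conv)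
  qed
  then have "parent0 t L \<noteq> Atom"
    using inf \<open>covers L A\<close> \<open>covers L B\<close> by (auto simp: inferred_def w_resolution_def)
  moreover have "\<not> covered L t"
    using False covered_iff_covers[OF L t] by simp
  ultimately have "covered (update t L) t"
    using c subsumes_cut_out by (auto simp: update_def covered_def)
  then show ?thesis using covered_iff_covers[OF L' t] by simp
qed

lemma fold_update_mono: "set (slist L) \<subseteq> set (slist (fold update ts L))"
proof (induction ts arbitrary: L)
  case (Cons t ts)
  show ?case using Cons[of "update t L"] update_mono[of L t] by auto
qed simp

lemma fold_update_covered:
  "(\<And>t. t \<in> set ts \<Longrightarrow> covered L t) \<Longrightarrow> fold update ts L = L"
  by (induction ts) (auto simp: update_covered)

text \<open>An update adds a line only for an item that was not covered, and it covers that item.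
  Coverage is never lost, so the lines are at most as many as the covered items, no matter how many
  scans are made.\<close>

lemma length_saturate:
  assumes "list_all2 encodes_item is ts"
  shows "length (slist (saturate (enc_list ts))) \<le> length ts"
proof -
  let ?I = "\<lambda>L. length (slist L) \<le> card {k. k < length ts \<and> covered L (ts ! k)}"
  have step: "?I (update t L)" if I: "?I L" and "t \<in> set ts" for t L
  proof (cases "update t L = L")
    case False
    obtain k where k: "k < length ts" "ts ! k = t"
      using \<open>t \<in> set ts\<close> by (auto simp: in_set_conv_nth)
    then have "encodes_item (is ! k) t"
      using assms by (auto simp: list_all2_conv_all_nth)
    from update_extends[OF this, of L] False
    have *: "covered (update t L) t" "length (slist (update t L)) = Suc (length (slist L))" by auto
    have "\<not> covered L t" using False update_covered by blast
    then have "{k. k < length ts \<and> covered L (ts ! k)} \<subset>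
        {k. k < length ts \<and> covered (update t L) (ts ! k)}"
      using k *(1) covered_mono[OF update_mono] by blast
    then have "card {k. k < length ts \<and> covered L (ts ! k)} <
        card {k. k < length ts \<and> covered (update t L) (ts ! k)}"
      by (intro psubset_card_mono) auto
    then show ?thesis using * I by simp
  qed (use I in simp)
  have pass: "?I (fold update us L)" if "?I L" "set us \<subseteq> set ts" for us L
    using that by (induction us arbitrary: L) (auto simp: step)
  have "?I (fold (\<lambda>_. fold update ts) vs L)" if "?I L" for vs :: "sexp list" and L
    using that by (induction vs arbitrary: L) (auto simp: pass)
  from this[of Atom ts] have "?I (saturate (enc_list ts))"
    by (simp add: saturate_def)
  also have "card {k. k < length ts \<and> covered (saturate (enc_list ts)) (ts ! k)} \<le> length ts"
    using card_mono[of "{..<length ts}" "{k. k < length ts \<and> covered (saturate (enc_list ts)) (ts ! k)}"]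
    by auto
  finally show ?thesis .
qed

lemma saturate_funpow: "saturate (enc_list ts) = (fold update ts ^^ length ts) Atom"
  by (simp add: saturate_def fold_const)

text \<open>A dag may list a node before its predecessors, so the induction follows
  \<open>rank\<close>: scan number \<open>p\<close>, counted from 0, covers all items of rank
  \<open>p\<close>. As ranks are below the number of items, one scan per item is enough.\<close>

lemma saturate_ranked:
  fixes rank :: "nat \<Rightarrow> nat"
  assumes enc: "list_all2 encodes_item is ts"
    and init: "\<And>C. (None, C) \<in> set is \<Longrightarrow> C \<in> F"
    and inf: "\<And>k x C. k < length is \<Longrightarrow> is ! k = (Some x, C) \<Longrightarrow>
      \<exists>i < length is. \<exists>j < length is. rank i < rank k \<and> rank j < rank k \<and>
        inferred w_resolution x (snd (is ! i)) (snd (is ! j)) C"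
    and rank: "\<And>k. k < length is \<Longrightarrow> rank k < length is"
    and k: "k < length is"
  shows "derivation F (slist (saturate (enc_list ts)))"
    and "covers (saturate (enc_list ts)) (snd (is ! k))"
proof -
  have len: "length ts = length is" using enc by (simp add: list_all2_lengthD)
  have enc_nth: "encodes_item (is ! m) (ts ! m)" if "m < length is" for m
    using enc that by (simp add: list_all2_conv_all_nth)
  have pass: "derivation F (slist (fold update (take m ts) L)) \<and>
      (\<forall>k<m. rank k \<le> p \<longrightarrow> covers (fold update (take m ts) L) (snd (is ! k)))"
    if L: "derivation F (slist L)"
      and p: "\<And>k. k < length is \<Longrightarrow> rank k < p \<Longrightarrow> covers L (snd (is ! k))"
      and "m \<le> length is" for m L p
    using \<open>m \<le> length is\<close>
  proof (induction m)
    case 0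
    then show ?case using L by simp
  next
    case (Suc m)
    let ?M = "fold update (take m ts) L"
    have m: "m < length is" using Suc.prems by simp
    have M: "derivation F (slist ?M)"
      "\<And>k. k < m \<Longrightarrow> rank k \<le> p \<Longrightarrow> covers ?M (snd (is ! k))"
      using Suc by auto
    have fold: "fold update (take (Suc m) ts) L = update (ts ! m) ?M"
      using m by (simp add: take_Suc_conv_app_nth len)
    have U: "derivation F (slist (update (ts ! m) ?M))"
      using update_derivation[OF M(1) enc_nth[OF m]] init nth_mem[OF m]
      by (metis prod.collapse)
    have "covers (update (ts ! m) ?M) (snd (is ! m))" if "rank m \<le> p"
    proof (cases "is ! m")
      case (Pair o' C)
      show ?thesis
      proof (cases o')
        case None
        then show ?thesis
          using covers_update_initial[OF U] enc_nth[OF m] Pair by simp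
      next
        case (Some x)
        obtain i j where ij: "i < length is" "j < length is" "rank i < rank m" "rank j < rank m"
            "inferred w_resolution x (snd (is ! i)) (snd (is ! j)) C"
          using inf[OF m, of x C] Pair Some by auto
        have "covers ?M (snd (is ! i))" "covers ?M (snd (is ! j))"
          using p[OF ij(1)] p[OF ij(2)] ij(3,4) that covers_mono[OF fold_update_mono] by auto
        then show ?thesis
          using covers_update_inference[OF M(1) _ _ _ ij(5)] enc_nth[OF m] Pair Some by simp
      qed
    qed
    moreover have "covers (update (ts ! m) ?M) (snd (is ! k))" if "k < m" "rank k \<le> p" for k
      using M(2)[OF that] covers_mono[OF update_mono] by blast
    ultimately show ?case
      unfolding fold using U by (auto simp: less_Suc_eq)
  qed
  have passes: "derivation F (slist ((fold update ts ^^ p) Atom)) \<and>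
      (\<forall>k < length is. rank k < p \<longrightarrow> covers ((fold update ts ^^ p) Atom) (snd (is ! k)))" for p
  proof (induction p)
    case 0
    show ?case by (simp add: derivation.Nil)
  next
    case (Suc p)
    let ?L = "(fold update ts ^^ p) Atom"
    have "derivation F (slist (fold update (take (length is) ts) ?L)) \<and>
        (\<forall>k<length is. rank k \<le> p \<longrightarrow> covers (fold update (take (length is) ts) ?L) (snd (is ! k)))"
      using Suc by (intro pass) auto
    then show ?case by (auto simp: len[symmetric])
  qed
  show "derivation F (slist (saturate (enc_list ts)))"
    and "covers (saturate (enc_list ts)) (snd (is ! k))"
    using passes[of "length ts"] rank[OF k] k by (simp_all add: saturate_funpow len)
qed

text \<open>Order matters for leaves: a lemma must be reached after its source, or it could be
  recorded as an initial clause. When sources and premises come earlier, the first scan covers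
  everything and the remaining ones change nothing.\<close>

lemma saturate_ordered:
  assumes enc: "list_all2 encodes_item is ts"
    and init: "\<And>k C. k < length is \<Longrightarrow> is ! k = (None, C) \<Longrightarrow>
      C \<in> F \<or> (\<exists>i<k. snd (is ! i) = C)"
    and inf: "\<And>k x C. k < length is \<Longrightarrow> is ! k = (Some x, C) \<Longrightarrow>
      \<exists>i<k. \<exists>j<k. inferred w_resolution x (snd (is ! i)) (snd (is ! j)) C"
    and k: "k < length is"
  shows "derivation F (slist (saturate (enc_list ts)))"
    and "covers (saturate (enc_list ts)) (snd (is ! k))"
proof -
  have len: "length ts = length is" using enc by (simp add: list_all2_lengthD)
  have enc_nth: "encodes_item (is ! m) (ts ! m)" if "m < length is" for m
    using enc that by (simp add: list_all2_conv_all_nth)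
  have pass: "derivation F (slist (fold update (take m ts) Atom)) \<and>
      (\<forall>k<m. covers (fold update (take m ts) Atom) (snd (is ! k)))"
    if "m \<le> length is" for m
    using that
  proof (induction m)
    case 0
    then show ?case by (simp add: derivation.Nil)
  next
    case (Suc m)
    let ?M = "fold update (take m ts) Atom"
    have m: "m < length is" using Suc.prems by simp
    have M: "derivation F (slist ?M)" "\<And>k. k < m \<Longrightarrow> covers ?M (snd (is ! k))"
      using Suc by auto
    have fold: "fold update (take (Suc m) ts) Atom = update (ts ! m) ?M"
      using m by (simp add: take_Suc_conv_app_nth len)
    have U: "derivation F (slist (update (ts ! m) ?M))"
      using update_derivation[OF M(1) enc_nth[OF m]] init[OF m] M(2)
      by (metis prod.collapse)
    have "covers (update (ts ! m) ?M) (snd (is ! m))"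
    proof (cases "is ! m")
      case (Pair o' C)
      show ?thesis
      proof (cases o')
        case None
        then show ?thesis
          using covers_update_initial[OF U] enc_nth[OF m] Pair by simp
      next
        case (Some x)
        obtain i j where ij: "i < m" "j < m"
            "inferred w_resolution x (snd (is ! i)) (snd (is ! j)) C"
          using inf[OF m, of x C] Pair Some by auto
        show ?thesis
          using covers_update_inference[OF M(1) _ M(2)[OF ij(1)] M(2)[OF ij(2)] ij(3)]
            enc_nth[OF m] Pair Some by simp
      qed
    qed
    moreover have "covers (update (ts ! m) ?M) (snd (is ! k))" if "k < m" for k
      using M(2)[OF that] covers_mono[OF update_mono] by blast
    ultimately show ?case
      unfolding fold using U by (auto simp: less_Suc_eq)
  qed
  let ?L = "fold update ts Atom"
  have L: "derivation F (slist ?L)" "\<And>k. k < length is \<Longrightarrow> covers ?L (snd (is ! k))"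
    using pass[of "length is"] by (auto simp: len[symmetric])
  have "covered ?L t" if "t \<in> set ts" for t
    using that L covered_iff_covers[OF L(1) enc_nth] by (metis in_set_conv_nth len)
  then have fix_pt: "fold update ts ?L = ?L" by (rule fold_update_covered)
  have "(fold update ts ^^ Suc n) Atom = ?L" for n
    by (induction n) (simp_all add: fix_pt)
  moreover have "0 < length ts" using k len by linarith
  then obtain n where "length ts = Suc n" using gr0_conv_Suc by blast
  ultimately have "saturate (enc_list ts) = ?L"
    by (simp only: saturate_funpow)
  with L k show "derivation F (slist (saturate (enc_list ts)))"
    and "covers (saturate (enc_list ts)) (snd (is ! k))" by simp_all
qed

section \<open>Saturation of given dags and trees\<close>

primrec node_item :: "dag_node \<Rightarrow> var option \<times> clause" where
  "node_item (Source C) = (None, C)"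
| "node_item (Inner i j x C) = (Some x, C)"

primrec tree_item :: "tree \<Rightarrow> var option \<times> clause" where
  "tree_item (Leaf C) = (None, C)"
| "tree_item (Node l x C r) = (Some x, C)"

lemma snd_node_item [simp]: "snd (node_item N) = node_clause N"
  by (cases N) auto

lemma snd_tree_item [simp]: "snd (tree_item T) = tree_clause T"
  by (cases T) auto

text \<open>Loop invariant: the postorders of the pending trees, from the bottom of the stack to its
  top, followed by the items already produced, make up the postorder of \<open>T\<close>.\<close>

lemma slist_flatten:
  assumes "encodes_tree T v"
  shows "list_all2 encodes_item (map tree_item (postorder T)) (slist (flatten v))"
proof -
  let ?po = "\<lambda>T. map tree_item (postorder T)"
  let ?P = "\<lambda>w. \<exists>Ts is. list_all2 encodes_tree Ts (slist (sfst w)) \<and>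
    list_all2 encodes_item is (slist (ssnd w)) \<and> concat (map ?po (rev Ts)) @ is = ?po T"
  let ?w = "while (\<lambda>w. sfst w \<noteq> Atom) flat_step (Pair (Pair v Atom) Atom)"
  have "?P ?w \<and> sfst ?w = Atom"
  proof (rule while_rule[where P = ?P and r = "Wellfounded.measure (\<lambda>w. weight (sfst w))"])
    show "?P (Pair (Pair v Atom) Atom)"
      using assms by (intro exI[of _ "[T]"] exI[of _ "[]"]) simp
  next
    fix w
    assume w: "sfst w \<noteq> Atom" and "?P w"
    then obtain Ts "is" where P: "list_all2 encodes_tree Ts (slist (sfst w))"
        "list_all2 encodes_item is (slist (ssnd w))" "concat (map ?po (rev Ts)) @ is = ?po T"
      by blast
    obtain t ts out where w: "w = Pair (Pair t ts) out"
      using w by (cases w; cases "sfst w") auto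
    obtain U Us where U: "Ts = U # Us" "encodes_tree U t" "list_all2 encodes_tree Us (slist ts)"
      using P(1) by (auto simp: w list_all2_Cons2)
    show "?P (flat_step w)"
    proof (cases U)
      case (Leaf C)
      then show ?thesis
        using U P(2,3) by (intro exI[of _ Us] exI[of _ "(None, C) # is"])
          (auto simp: w flat_step_def)
    next
      case (Node l x C r)
      then obtain a b c where t: "t = Pair (Pair a b) (Pair (enc_binary x) c)" "encodes_tree l a"
          "encodes_tree r b" "encodes_clause C c"
        using U(2) by auto
      show ?thesis
        using U P(2,3) Node t by (intro exI[of _ "r # l # Us"] exI[of _ "(Some x, C) # is"])
          (auto simp: w flat_step_def)
    qed
  qed (auto simp: flat_step)
  then obtain Ts "is" where "list_all2 encodes_tree Ts (slist (sfst ?w))"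
        "list_all2 encodes_item is (slist (ssnd ?w))" "concat (map ?po (rev Ts)) @ is = ?po T"
        "sfst ?w = Atom" by blast
  then show ?thesis by (simp add: flatten_def)
qed

lemma root_in_postorder: "T \<in> set (postorder T)"
  by (cases T) auto

lemma postorder_root: "\<exists>k < length (postorder T). postorder T ! k = T"
  using root_in_postorder[of T] by (simp add: in_set_conv_nth)

lemma postorder_children:
  assumes "k < length (postorder T)" "postorder T ! k = Node l x C r"
  shows "(\<exists>i<k. postorder T ! i = l) \<and> (\<exists>j<k. postorder T ! j = r)"
  using assms
proof (induction T arbitrary: k)
  case (Node L y D R)
  let ?L = "postorder L" and ?R = "postorder R"
  consider "k < length ?L" | "length ?L \<le> k" "k < length ?L + length ?R" | "k = length ?L + length ?R"
    using Node.prems(1) by fastforce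
  then show ?case
  proof cases
    case 1
    then show ?thesis using Node.IH(1)[of k] Node.prems by (auto simp: nth_append intro: less_trans)
  next
    case 2
    then have "(\<exists>i<k - length ?L. ?R ! i = l) \<and> (\<exists>j<k - length ?L. ?R ! j = r)"
      using Node.IH(2)[of "k - length ?L"] Node.prems
      by (auto simp: nth_append less_diff_conv2 add.commute)
    then obtain i j where "i < k - length ?L" "?R ! i = l" "j < k - length ?L" "?R ! j = r" by blast
    with 2 show ?thesis
      by (intro conjI exI[of _ "length ?L + i"] exI[of _ "length ?L + j"]) (auto simp: nth_append)
  next
    case 3
    then have [simp]: "l = L" "r = R" using Node.prems by (auto simp: nth_append)
    obtain i j where "i < length ?L" "?L ! i = L" "j < length ?R" "?R ! j = R" using postorder_root by blast
    with 3 show ?thesis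
      by (intro conjI exI[of _ i] exI[of _ "length ?L + j"]) (auto simp: nth_append)
  qed
qed simp

text \<open>The rank of a node counts the nodes from which it can be reached. Along an edge this set
  grows strictly, and it never contains the node itself, hence the bound \<open>n\<close>.\<close>

lemma acyclic_rank:
  fixes E :: "(nat \<times> nat) set"
  assumes "acyclic E" "E \<subseteq> {..<n} \<times> {..<n}"
  obtains rank :: "nat \<Rightarrow> nat" where "\<And>i k. (i, k) \<in> E \<Longrightarrow> rank i < rank k"
    and "\<And>k. k < n \<Longrightarrow> rank k < n"
proof
  define S where "S k = {i. (i, k) \<in> E\<^sup>+}" for k
  have sub: "S k \<subseteq> {..<n}" for k
    using assms(2) by (auto simp: S_def dest!: tranclD)
  have irr: "k \<notin> S k" for k
    using assms(1) by (auto simp: S_def acyclic_def)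
  show "card (S i) < card (S k)" if "(i, k) \<in> E" for i k
  proof (rule psubset_card_mono)
    show "finite (S k)" using sub finite_subset by blast
    have "S i \<subseteq> S k" using that by (auto simp: S_def intro: trancl_into_trancl)
    moreover have "i \<in> S k" using that by (auto simp: S_def)
    ultimately show "S i \<subset> S k" using irr[of i] by blast
  qed
  show "card (S k) < n" if "k < n" for k
    using psubset_card_mono[of "{..<n}" "S k"] sub[of k] irr[of k] that by auto
qed

lemma saturate_dag:
  assumes "WRD F \<pi>" "encodes \<pi> v"
  shows "derivation F (slist (saturate (items v)))"
    and "Atom \<in> label ` set (slist (saturate (items v)))"
    and "length (slist (saturate (items v))) \<le> refutation_size \<pi>"
proof -
  obtain D r where D: "\<pi> = Dag D" "dag_derivation w_resolution F D" "sinks D = {r}"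
      "node_clause (D ! r) = {||}"
    using assms(1) by (auto simp: WRD_def dag_refutation_def)
  obtain ts where ts: "list_all2 encodes_node D ts" "v = Pair Atom (enc_list ts)"
    using assms(2) D(1) by (auto simp: enc_bool_def)
  have items: "items v = enc_list ts" by (simp add: items_def ts)
  have node: "encodes_item (node_item N) t" if "encodes_node N t" for N t
    using that by (cases N) auto
  have enc: "list_all2 encodes_item (map node_item D) ts"
    using ts(1) by (auto simp: list_all2_map1 intro: list_all2_mono node)
  have r: "r < length D" using D(3) by (auto simp: sinks_def)
  have nodes: "case D ! k of Source C \<Rightarrow> C \<in> F
      | Inner i j x C \<Rightarrow> i < length D \<and> j < length D \<and> i \<noteq> j \<and>
          inferred w_resolution x (node_clause (D ! i)) (node_clause (D ! j)) C" if "k < length D" for k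
    using D(2) that by (simp add: dag_derivation_def)
  have "dag_edges D \<subseteq> {..<length D} \<times> {..<length D}"
  proof (rule subrelI)
    fix i k assume "(i, k) \<in> dag_edges D"
    then have k: "k < length D" "i \<in> preds (D ! k)" by (auto simp: dag_edges_def)
    then show "(i, k) \<in> {..<length D} \<times> {..<length D}"
      using nodes[OF k(1)] by (cases "D ! k") auto
  qed
  moreover have "acyclic (dag_edges D)" using D(2) by (simp add: dag_derivation_def)
  ultimately obtain rank where rank: "\<And>i k. (i, k) \<in> dag_edges D \<Longrightarrow> rank i < (rank k :: nat)"
      "\<And>k. k < length D \<Longrightarrow> rank k < length D"
    using acyclic_rank[of "dag_edges D" "length D"] by blast
  have init: "C \<in> F" if mem: "(None, C) \<in> set (map node_item D)" for C
  proof -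
    obtain k where k: "k < length D" "node_item (D ! k) = (None, C)"
      using mem by (metis in_set_conv_nth length_map nth_map)
    then show ?thesis using nodes[OF k(1)] by (cases "D ! k") auto
  qed
  have inf: "\<exists>i < length (map node_item D). \<exists>j < length (map node_item D).
      rank i < rank k \<and> rank j < rank k \<and>
      inferred w_resolution x (snd (map node_item D ! i)) (snd (map node_item D ! j)) C"
    if k: "k < length (map node_item D)" "map node_item D ! k = (Some x, C)" for k x C
  proof -
    from k obtain i j where ij: "D ! k = Inner i j x C" by (cases "D ! k") auto
    with nodes[of k] k(1) rank(1)[of i k] rank(1)[of j k] show ?thesis
      by (intro exI[of _ i] exI[of _ j] conjI) (auto simp: dag_edges_def)
  qed
  note sat = saturate_ranked[where rank = rank and k = r, OF enc init inf]
  have der: "derivation F (slist (saturate (enc_list ts)))"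
    using sat(1) rank(2) r by simp
  then show "derivation F (slist (saturate (items v)))" by (simp add: items)
  have "covers (saturate (enc_list ts)) {||}"
    using sat(2) rank(2) r D(4) by simp
  \<comment> \<open>A subclause of the empty clause is empty, and its only encoding is
    \<open>Atom\<close>.\<close>
  then show "Atom \<in> label ` set (slist (saturate (items v)))"
    unfolding covers_def items by (auto intro: rev_image_eqI)
  show "length (slist (saturate (items v))) \<le> refutation_size \<pi>"
    using length_saturate[OF enc] list_all2_lengthD[OF enc] by (simp add: items D(1))
qed

lemma saturate_tree:
  assumes "WRTL F \<pi>" "encodes \<pi> v"
  shows "derivation F (slist (saturate (items v)))"
    and "Atom \<in> label ` set (slist (saturate (items v)))"
    and "length (slist (saturate (items v))) \<le> refutation_size \<pi>"
proof -
  obtain T where T: "\<pi> = Tree T" "tree_derivation (\<lambda>_. True) w_resolution F T" "tree_clause T = {||}"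
    using assms(1) by (auto simp: WRTL_def tree_refutation_def)
  obtain w where w: "encodes_tree T w" "v = Pair (Pair Atom Atom) w"
    using assms(2) T(1) by (auto simp: enc_bool_def)
  have items: "items v = enc_list (slist (flatten w))" by (simp add: items_def w)
  let ?is = "map tree_item (postorder T)"
  have enc: "list_all2 encodes_item ?is (slist (flatten w))"
    using slist_flatten[OF w(1)] .
  have nodes: "case postorder T ! k of Leaf C \<Rightarrow> C \<in> F \<or> (\<exists>u < k. tree_clause (postorder T ! u) = C)
      | Node l x C r \<Rightarrow> inferred w_resolution x (tree_clause l) (tree_clause r) C"
    if "k < length (postorder T)" for k
    using T(2)[unfolded tree_derivation_def, rule_format, OF that]
    by (cases "postorder T ! k") auto
  obtain root where root: "root < length (postorder T)" "postorder T ! root = T"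
    using postorder_root by blast
  have init: "C \<in> F \<or> (\<exists>i<k. snd (?is ! i) = C)"
    if k: "k < length ?is" "?is ! k = (None, C)" for k C
  proof -
    have leaf: "postorder T ! k = Leaf C" using k by (cases "postorder T ! k") auto
    then have "C \<in> F \<or> (\<exists>i<k. tree_clause (postorder T ! i) = C)"
      using nodes[of k] k(1) by simp
    then show ?thesis using k(1) by (metis length_map less_trans nth_map snd_tree_item)
  qed
  have inf: "\<exists>i<k. \<exists>j<k. inferred w_resolution x (snd (?is ! i)) (snd (?is ! j)) C"
    if k: "k < length ?is" "?is ! k = (Some x, C)" for k x C
  proof -
    obtain l r where node: "postorder T ! k = Node l x C r" using k by (cases "postorder T ! k") auto
    obtain i j where "i < k" "postorder T ! i = l" "j < k" "postorder T ! j = r"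
      using postorder_children[OF _ node] k(1) by auto
    with nodes[of k] node k(1) show ?thesis
      by (intro exI[of _ i] conjI exI[of _ j]) auto
  qed
  note sat = saturate_ordered[where k = root, OF enc init inf]
  have "derivation F (slist (saturate (enc_list (slist (flatten w)))))"
    using sat(1) root(1) by simp
  then show "derivation F (slist (saturate (items v)))" by (simp only: items)
  have "covers (saturate (enc_list (slist (flatten w)))) {||}"
    using sat(2) root T(3) by simp
  then show "Atom \<in> label ` set (slist (saturate (items v)))"
    unfolding covers_def items by (auto intro: rev_image_eqI)
  show "length (slist (saturate (items v))) \<le> refutation_size \<pi>"
    using length_saturate[OF enc] list_all2_lengthD[OF enc] by (simp add: items T(1))
qed

section \<open>Correctness of the extracted dag\<close>

text \<open>The justification of a single line relative to a set of available clauses. It is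
  detached from the order of the list, which pruning reverses.\<close>

definition line_from :: "clause set \<Rightarrow> sexp set \<Rightarrow> sexp \<Rightarrow> bool" where
  "line_from F cs l \<longleftrightarrow>
     (\<exists>C c. l = Pair Atom c \<and> encodes_clause C c \<and> C \<in> F) \<or>
     (\<exists>a b x c A B C. l = Pair (Pair a b) (Pair (enc_binary x) c) \<and> a \<in> cs \<and> b \<in> cs \<and> a \<noteq> b \<and>
        encodes_clause A a \<and> encodes_clause B b \<and> encodes_clause C c \<and> resolution x A B C)"

lemma derivation_Cons:
  assumes "derivation F (l # L)"
  shows "derivation F L" "line_from F (label ` set L) l"
proof -
  from assms have "derivation F L \<and> line_from F (label ` set L) l"
  proof cases
    case (initial C c)
    then show ?thesis unfolding line_from_def by blast
  next
    case (inference a b A B C x c)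
    then show ?thesis unfolding line_from_def by blast
  qed
  then show "derivation F L" "line_from F (label ` set L) l" by blast+
qed

text \<open>The invariant of \<open>prune\<close> when it has kept the lines \<open>os\<close>, oldest first, and the older
  lines \<open>L\<close> are still to be examined.\<close>

definition pruning :: "clause set \<Rightarrow> sexp list \<Rightarrow> sexp list \<Rightarrow> bool" where
  "pruning F L os \<longleftrightarrow>
     distinct (map label (L @ os)) \<and> Atom \<in> label ` (set L \<union> set os) \<and>
     (\<forall>k < length os. line_from F (label ` (set (take k os) \<union> set L)) (os ! k)) \<and>
     (\<forall>l \<in> set os. label l = Atom \<or>
        (\<exists>k \<in> set os. label l = sfst (sfst k) \<or> label l = ssnd (sfst k)))"

lemma pruning_fold:
  assumes "derivation F L" "pruning F L (slist out)"
  shows "pruning F [] (slist (fold (\<lambda>l out. if needed l out then Pair l out else out) L out))"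
  using assms
proof (induction L arbitrary: out rule: list.induct)
  case (Cons l L)
  note l = derivation_Cons[OF Cons.prems(1)]
  let ?os = "slist out"
  have P: "distinct (map label ((l # L) @ ?os))" "Atom \<in> label ` (set (l # L) \<union> set ?os)"
    "\<And>k. k < length ?os \<Longrightarrow> line_from F (label ` (set (take k ?os) \<union> set (l # L))) (?os ! k)"
    "\<And>m. m \<in> set ?os \<Longrightarrow> label m = Atom \<or>
        (\<exists>k \<in> set ?os. label m = sfst (sfst k) \<or> label m = ssnd (sfst k))"
    using Cons.prems(2) unfolding pruning_def by blast+
  show ?case
  proof (cases "needed l out")
    case True
    have "pruning F L (l # ?os)"
      unfolding pruning_def
    proof (intro conjI allI ballI impI)
      show "distinct (map label (L @ l # ?os))" using P(1) by auto
      show "Atom \<in> label ` (set L \<union> set (l # ?os))" using P(2) by auto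
      show "line_from F (label ` (set (take k (l # ?os)) \<union> set L)) ((l # ?os) ! k)"
        if "k < length (l # ?os)" for k
      proof (cases k)
        case 0
        then show ?thesis using l(2) by simp
      next
        case (Suc j)
        then show ?thesis using P(3)[of j] that by simp
      qed
      show "label m = Atom \<or>
          (\<exists>k \<in> set (l # ?os). label m = sfst (sfst k) \<or> label m = ssnd (sfst k))"
        if "m \<in> set (l # ?os)" for m
        using that P(4)[of m] True by (auto simp: needed_def)
    qed
    then show ?thesis using Cons.IH[OF l(1), of "Pair l out"] True by simp
  next
    case False
    have "pruning F L ?os"
      unfolding pruning_def
    proof (intro conjI allI ballI impI)
      show "distinct (map label (L @ ?os))" using P(1) by auto
      show "Atom \<in> label ` (set L \<union> set ?os)" using P(2) False by (auto simp: needed_def)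
      show "line_from F (label ` (set (take k ?os) \<union> set L)) (?os ! k)" if "k < length ?os" for k
      proof -
        \<comment> \<open>A dropped line is no premise of a kept one, so the justifications survive
          its removal.\<close>
        have "?os ! k \<in> set ?os" using that by simp
        then have "label l \<noteq> sfst (sfst (?os ! k))" "label l \<noteq> ssnd (sfst (?os ! k))"
          using False unfolding needed_def by blast+
        then show ?thesis using P(3)[OF that] unfolding line_from_def by auto
      qed
      show "label m = Atom \<or>
          (\<exists>k \<in> set ?os. label m = sfst (sfst k) \<or> label m = ssnd (sfst k))"
        if "m \<in> set ?os" for m
        using P(4)[OF that] .
    qed
    then show ?thesis using Cons.IH[OF l(1), of out] False by simp
  qed
qed simp

lemma length_prune: "length (slist (prune L)) \<le> length (slist L)"
proof -
  have "length (slist (fold (\<lambda>l out. if needed l out then Pair l out else out) xs out))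
      \<le> length xs + length (slist out)" for xs out
  proof (induction xs arbitrary: out)
    case (Cons x xs)
    from Cons[of out] Cons[of "Pair x out"] show ?case by auto
  qed simp
  from this[of "slist L" Atom] show ?thesis by (simp add: prune_def)
qed

lemma pointer_nth:
  assumes "distinct (map label R)" "i < length R"
  shows "pointer (label (R ! i)) (enc_list R) = enc_unary i"
proof -
  have "enc_list (map (\<lambda>_. Atom) xs) = enc_unary (length xs)" for xs :: "sexp list"
    by (induction xs) auto
  moreover have "length (takeWhile (\<lambda>k. label k \<noteq> label (R ! i)) R) = i"
  proof -
    have "takeWhile (\<lambda>k. label k \<noteq> label (R ! i)) (take i R @ R ! i # drop (Suc i) R) = take i R"
    proof (subst takeWhile_append2)
      show "label k \<noteq> label (R ! i)" if "k \<in> set (take i R)" for k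
        using that assms by (auto simp: in_set_conv_nth distinct_conv_nth)
    qed simp
    then show ?thesis using assms(2) by (simp flip: id_take_nth_drop)
  qed
  ultimately show ?thesis by (simp add: pointer_def)
qed

text \<open>Oldest first, the kept lines are topologically sorted, so their positions serve as
  pointers. Every kept line other than the empty clause is a premise of a kept line, which leaves a
  single sink.\<close>

lemma RD_dag_of:
  assumes der: "derivation F (slist L)" and empty: "Atom \<in> label ` set (slist L)"
  shows "\<exists>\<pi>. encodes \<pi> (dag_of L) \<and> RD F \<pi> \<and> refutation_size \<pi> \<le> length (slist L)"
proof -
  define R where "R = slist (prune L)"
  have prune: "prune L = enc_list R" by (simp add: R_def)
  have "pruning F (slist L) (slist Atom)"
    using derivation_distinct[OF der] empty by (simp add: pruning_def)
  from pruning_fold[OF der this] have "pruning F [] R"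
    by (simp add: R_def prune_def)
  then have R: "distinct (map label R)" "Atom \<in> label ` set R"
    "\<And>k. k < length R \<Longrightarrow> line_from F (label ` set (take k R)) (R ! k)"
    "\<And>l. l \<in> set R \<Longrightarrow> label l = Atom \<or>
        (\<exists>k \<in> set R. label l = sfst (sfst k) \<or> label l = ssnd (sfst k))"
    unfolding pruning_def by simp_all
  have eq_index: "i = j" if "label (R ! i) = label (R ! j)" "i < length R" "j < length R" for i j
    using that R(1) by (auto simp: distinct_conv_nth)
  let ?ok = "\<lambda>k N. encodes_node N (link (enc_list R) (R ! k)) \<and>
    encodes_clause (node_clause N) (label (R ! k)) \<and>
    ((\<exists>C. N = Source C \<and> C \<in> F \<and> sfst (R ! k) = Atom) \<or>
     (\<exists>i j x A B C. N = Inner i j x C \<and> i < k \<and> j < k \<and> i \<noteq> j \<and>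
        label (R ! i) = sfst (sfst (R ! k)) \<and> label (R ! j) = ssnd (sfst (R ! k)) \<and>
        encodes_clause A (label (R ! i)) \<and> encodes_clause B (label (R ! j)) \<and> resolution x A B C))"
  have "\<exists>N. ?ok k N" if k: "k < length R" for k
    using R(3)[OF k] unfolding line_from_def
  proof (elim disjE exE conjE)
    fix C c assume "R ! k = Pair Atom c" "encodes_clause C c" "C \<in> F"
    then show ?thesis by (intro exI[of _ "Source C"]) (auto simp: link_def)
  next
    fix a b x c A B C
    assume l: "R ! k = Pair (Pair a b) (Pair (enc_binary x) c)" "a \<in> label ` set (take k R)"
      "b \<in> label ` set (take k R)" "a \<noteq> b" "encodes_clause A a" "encodes_clause B b"
      "encodes_clause C c" "resolution x A B C"
    obtain i where i: "i < k" "a = label (R ! i)"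
      using l(2) k by (auto simp: in_set_conv_nth)
    obtain j where j: "j < k" "b = label (R ! j)"
      using l(3) k by (auto simp: in_set_conv_nth)
    have "pointer a (enc_list R) = enc_unary i" "pointer b (enc_list R) = enc_unary j"
      using pointer_nth[OF R(1)] i j k by auto
    then show ?thesis
      using l i j by (intro exI[of _ "Inner i j x C"]) (auto simp: link_def)
  qed
  then obtain D where D: "length D = length R" "\<And>k. k < length R \<Longrightarrow> ?ok k (D ! k)"
    using Skolem_list_nth[of "length R" ?ok] by blast
  have clause: "node_clause (D ! k) = C" if "k < length R" "encodes_clause C (label (R ! k))" for k C
    using D(2)[OF that(1)] that(2) encodes_clause_unique by blast
  have edge: "i < k \<and> Pos x |\<in>| node_clause (D ! i) \<and> Neg x |\<in>| node_clause (D ! j)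
      \<and> j < k \<and> i \<noteq> j \<and> resolution x (node_clause (D ! i)) (node_clause (D ! j)) C \<and>
      label (R ! i) = sfst (sfst (R ! k)) \<and> label (R ! j) = ssnd (sfst (R ! k))"
    if k: "k < length R" and N: "D ! k = Inner i j x C" for i j k x C
  proof -
    obtain A B where AB: "i < k" "j < k" "i \<noteq> j" "encodes_clause A (label (R ! i))"
        "encodes_clause B (label (R ! j))" "resolution x A B C"
        "label (R ! i) = sfst (sfst (R ! k))" "label (R ! j) = ssnd (sfst (R ! k))"
      using D(2)[OF k] N by auto
    have "node_clause (D ! i) = A" "node_clause (D ! j) = B"
      using clause AB(1,2,4,5) k by auto
    with AB show ?thesis by (auto simp: resolution_def)
  qed
  \<comment> \<open>A premise of genuine resolution contains a pivot literal, so the empty clause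
    has no outgoing edge.\<close>
  have edges: "i < k \<and> node_clause (D ! i) \<noteq> {||}" if "(i, k) \<in> dag_edges D" for i k
  proof -
    have k: "k < length R" "i \<in> preds (D ! k)" using that D(1) by (auto simp: dag_edges_def)
    then obtain i' j' x C where "D ! k = Inner i' j' x C" by (cases "D ! k") auto
    with edge[OF k(1) this] k(2) show ?thesis by auto
  qed
  have "dag_edges D \<subseteq> less_than" using edges by (auto simp: less_than_iff)
  then have "acyclic (dag_edges D)"
    using acyclic_subset[OF wf_acyclic[OF wf_less_than]] by blast
  moreover have "case D ! k of Source C \<Rightarrow> C \<in> F
      | Inner i j x C \<Rightarrow> i < length D \<and> j < length D \<and> i \<noteq> j \<and>
          inferred resolution x (node_clause (D ! i)) (node_clause (D ! j)) C"
    if k: "k < length D" for k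
  proof (cases "D ! k")
    case (Source C)
    then show ?thesis using D k by fastforce
  next
    case (Inner i j x C)
    then show ?thesis using edge[of k i j x C] k D(1) by (auto simp: inferred_def)
  qed
  ultimately have derD: "dag_derivation resolution F D" by (simp add: dag_derivation_def)
  obtain r where r: "r < length R" "label (R ! r) = Atom"
    using R(2) by (auto simp: in_set_conv_nth)
  then have r': "node_clause (D ! r) = {||}" using clause by simp
  have "sinks D = {r}"
  proof (intro equalityI subsetI)
    fix k assume "k \<in> sinks D"
    then have k: "k < length R" "\<And>m. (k, m) \<notin> dag_edges D" using D(1) by (auto simp: sinks_def)
    have "label (R ! k) = Atom"
    proof (rule ccontr)
      assume ne: "label (R ! k) \<noteq> Atom"
      then obtain m where m: "m < length R"
          "label (R ! k) = sfst (sfst (R ! m)) \<or> label (R ! k) = ssnd (sfst (R ! m))"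
        using R(4)[of "R ! k"] k(1) by (metis in_set_conv_nth nth_mem)
      have "\<nexists>C. D ! m = Source C" using D(2)[OF m(1)] m(2) ne by auto
      then obtain i j x C where N: "D ! m = Inner i j x C" by (cases "D ! m") auto
      from edge[OF m(1) N] m(2) have "k = i \<or> k = j"
        using eq_index[of k] k(1) m(1) by auto
      then have "(k, m) \<in> dag_edges D" using N m(1) D(1) by (auto simp: dag_edges_def)
      with k(2) show False by blast
    qed
    with r eq_index[of k r] k(1) show "k \<in> {r}" by simp
  next
    fix k assume "k \<in> {r}"
    then show "k \<in> sinks D" using r(1) r' edges D(1) by (auto simp: sinks_def)
  qed
  with derD r' have "dag_refutation resolution F D" by (auto simp: dag_refutation_def)
  then have "RD F (Dag D)" by (simp add: RD_def)
  moreover have "encodes (Dag D) (dag_of L)"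
    using D by (auto simp: dag_of_def prune enc_bool_def list_all2_conv_all_nth
        intro!: exI[of _ "map (link (enc_list R)) R"])
  moreover have "refutation_size (Dag D) \<le> length (slist L)"
    using length_prune[of L] D(1) by (simp add: R_def)
  ultimately show ?thesis by blast
qed

section \<open>Correctness of the extracted tree\<close>

definition input_clauses :: "tree \<Rightarrow> clause set" where
  "input_clauses T = {tree_clause U |U. U \<in> set (postorder T) \<and> input_resolution_tree U}"

text \<open>The lemma condition in recursive form: \<open>S\<close> holds the lemmas supplied by
  what precedes the subtree, and the right subtree may also use input-derived nodes of the left
  one.\<close>

primrec lemma_tree :: "clause set \<Rightarrow> clause set \<Rightarrow> tree \<Rightarrow> bool" where
  "lemma_tree F S (Leaf C) \<longleftrightarrow> C \<in> F \<union> S"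
| "lemma_tree F S (Node l x C r) \<longleftrightarrow> inferred resolution x (tree_clause l) (tree_clause r) C \<and>
     lemma_tree F S l \<and> lemma_tree F (S \<union> input_clauses l) r"

text \<open>Positions in the right subtree are shifted by the number of nodes on the left. A lemma
  handed over from the left subtree as a set element becomes an explicit earlier position.\<close>

lemma lemma_tree_nth:
  assumes "lemma_tree F S T" "v < length (postorder T)"
  shows "case postorder T ! v of
      Leaf C \<Rightarrow> C \<in> F \<or> C \<in> S \<or>
        (\<exists>u<v. input_resolution_tree (postorder T ! u) \<and> tree_clause (postorder T ! u) = C)
    | Node l x C r \<Rightarrow> inferred resolution x (tree_clause l) (tree_clause r) C"
  using assms
proof (induction T arbitrary: S v)
  case (Leaf C)
  then show ?case by simp
next
  case (Node L y D R)
  let ?L = "postorder L" and ?R = "postorder R"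
  consider "v < length ?L" | "length ?L \<le> v" "v < length ?L + length ?R" | "v = length ?L + length ?R"
    using Node.prems(2) by fastforce
  then show ?case
  proof cases
    case 1
    have root: "postorder (Node L y D R) ! u = ?L ! u" if "u \<le> v" for u
      using that 1 by (simp add: nth_append)
    have "case ?L ! v of
        Leaf C \<Rightarrow> C \<in> F \<or> C \<in> S \<or>
          (\<exists>u<v. input_resolution_tree (?L ! u) \<and> tree_clause (?L ! u) = C)
      | Node l x C r \<Rightarrow> inferred resolution x (tree_clause l) (tree_clause r) C"
      using Node.IH(1)[of S v] Node.prems 1 by simp
    then show ?thesis
      unfolding root[OF order_refl] by (cases "?L ! v") (auto simp del: postorder.simps simp: root)
  next
    case 2
    define w where "w = v - length ?L"
    have w: "w < length ?R" "v = length ?L + w" using 2 by (auto simp: w_def)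
    have IH: "case ?R ! w of
        Leaf C \<Rightarrow> C \<in> F \<or> C \<in> S \<union> input_clauses L \<or>
          (\<exists>u<w. input_resolution_tree (?R ! u) \<and> tree_clause (?R ! u) = C)
      | Node l x C r \<Rightarrow> inferred resolution x (tree_clause l) (tree_clause r) C"
      using Node.IH(2)[of "S \<union> input_clauses L" w] Node.prems w by simp
    have root: "postorder (Node L y D R) ! v = ?R ! w" using w by (simp add: nth_append)
    show ?thesis
    proof (cases "?R ! w")
      case (Leaf C)
      have "\<exists>u<v. input_resolution_tree (postorder (Node L y D R) ! u) \<and>
          tree_clause (postorder (Node L y D R) ! u) = C" if "C \<in> input_clauses L"
      proof -
        obtain i where "i < length ?L" "input_resolution_tree (?L ! i)" "tree_clause (?L ! i) = C"
          using \<open>C \<in> input_clauses L\<close> by (auto simp: input_clauses_def in_set_conv_nth)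
        then show ?thesis using w by (intro exI[of _ i]) (auto simp: nth_append)
      qed
      moreover have "\<exists>u<v. input_resolution_tree (postorder (Node L y D R) ! u) \<and>
          tree_clause (postorder (Node L y D R) ! u) = C"
        if "u < w" "input_resolution_tree (?R ! u)" "tree_clause (?R ! u) = C" for u
        using that w by (intro exI[of _ "length ?L + u"]) (auto simp: nth_append)
      ultimately show ?thesis using IH Leaf root by auto
    next
      case (Node l x C r)
      then show ?thesis using IH root by simp
    qed
  next
    case 3
    then show ?thesis using Node.prems by (simp add: nth_append)
  qed
qed

lemma RTI_lemma_tree:
  assumes "lemma_tree F {} T" "tree_clause T = {||}"
  shows "RTI F (Tree T)"
proof -
  have "case postorder T ! v of
      Leaf C \<Rightarrow> C \<in> F \<or>
        (\<exists>u<v. input_resolution_tree (postorder T ! u) \<and> tree_clause (postorder T ! u) = C)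
    | Node l x C r \<Rightarrow> inferred resolution x (tree_clause l) (tree_clause r) C"
    if "v < length (postorder T)" for v
    using lemma_tree_nth[OF assms(1) that] by (cases "postorder T ! v") auto
  with assms(2) show ?thesis
    by (simp add: RTI_def tree_refutation_def tree_derivation_def)
qed

lemma lookup_label:
  assumes "distinct (map label (slist L))" "l \<in> set (slist L)"
  shows "lookup (label l) L = l"
proof -
  have "filter (\<lambda>m. label m = label l) xs = [l]"
    if "distinct (map label xs)" "l \<in> set xs" for xs
    using that by (induction xs) (auto simp: filter_empty_conv image_iff)
  with assms show ?thesis by (simp add: lookup_def)
qed

lemma search_visit:
  "search L (Pair (Pair (visit c) todo) (Pair out lr)) =
    (if sfst (lookup c L) = Atom \<or> c \<in> set (slist lr)
     then Pair todo (Pair (Pair (Pair Atom c) out) lr)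
     else Pair (Pair (visit (sfst (sfst (lookup c L)))) (Pair (visit (ssnd (sfst (lookup c L))))
       (Pair (build c) todo))) (Pair out lr))"
  by (simp add: search_def visit_def)

lemma search_build:
  "search L (Pair (Pair (build c) todo) (Pair (Pair t (Pair s out)) lr)) =
    Pair todo (Pair (Pair (Pair (Pair s t) (ssnd (lookup c L))) out)
      (if sfst s = Atom \<and> sfst t = Atom then Pair c lr else lr))"
  by (simp add: search_def build_def)

definition knows :: "clause set \<Rightarrow> sexp \<Rightarrow> bool" where
  "knows S lr \<longleftrightarrow> (\<forall>y \<in> set (slist lr). \<exists>C \<in> S. encodes_clause C y)"

lemma input_clauses_Node: "input_clauses l \<union> input_clauses r \<subseteq> input_clauses (Node l x C r)"
  by (auto simp: input_clauses_def)

text \<open>Every visit that does not end in a leaf learns a clause, namely at a lowest inner node that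
  it creates. Inner nodes that are not lowest are paid for by the height \<open>h\<close> of the dag.\<close>

lemma search_run:
  assumes der: "derivation F (slist L)"
    and "slist L = pre @ l # suf"
    and "knows S lr" "distinct (slist lr)" "set (slist lr) \<subseteq> label ` set (slist L)"
  shows "\<exists>m t T lr'.
    (search L ^^ m) (Pair (Pair (visit (label l)) todo) (Pair out lr)) =
      Pair todo (Pair (Pair t out) lr') \<and>
    encodes_tree T t \<and> encodes_clause (tree_clause T) (label l) \<and> lemma_tree F S T \<and>
    knows (S \<union> input_clauses T) lr' \<and> distinct (slist lr') \<and>
    set (slist lr') \<subseteq> label ` set (slist L) \<and>
    (if sfst t = Atom then lr' = lr else length (slist lr) < length (slist lr')) \<and>
    length (postorder T) \<le> 2 * length suf * (length (slist lr') - length (slist lr)) + 1 \<and>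
    m \<le> 2 * length (postorder T)"
  using assms(2-)
proof (induction "length suf" arbitrary: pre l suf S lr todo out rule: less_induct)
  case less
  note kn = less.prems(2) and dist = less.prems(3) and sub = less.prems(4)
  have l: "l \<in> set (slist L)" using less.prems(1) by simp
  have lookup: "lookup (label l) L = l"
    using lookup_label[OF derivation_distinct[OF der] l] .
  have "derivation F (l # suf)"
    using der unfolding less.prems(1)
    by (induction pre) (auto dest: derivation_Cons(1))
  then have line: "line_from F (label ` set suf) l" by (rule derivation_Cons)
  obtain C where C: "encodes_clause C (label l)" using derivation_encodes[OF der l] by blast
  show ?case
  proof (cases "sfst l = Atom \<or> label l \<in> set (slist lr)")
    case True
    have "C \<in> F \<union> S"
    proof (cases "label l \<in> set (slist lr)")
      case True
      then obtain D where "D \<in> S" "encodes_clause D (label l)" using kn by (auto simp: knows_def)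
      then show ?thesis using C encodes_clause_unique by blast
    next
      case False
      then have "sfst l = Atom" using True by blast
      with line have "\<exists>D\<in>F. encodes_clause D (label l)" by (auto simp: line_from_def)
      then show ?thesis using C encodes_clause_unique by blast
    qed
    then show ?thesis
      using True kn dist sub C lookup
      by (intro exI[of _ 1] exI[of _ "Pair Atom (label l)"] exI[of _ "Leaf C"] exI[of _ lr])
        (auto simp: search_visit knows_def)
  next
    case False
    with line obtain a b x c A B C' where inner: "l = Pair (Pair a b) (Pair (enc_binary x) c)"
        "a \<in> label ` set suf" "b \<in> label ` set suf" "a \<noteq> b" "encodes_clause A a"
        "encodes_clause B b" "encodes_clause C' c" "resolution x A B C'"
      by (auto simp: line_from_def)
    have c: "label l = c" using inner(1) by simp
    then have lookup_c: "lookup c L = l" using lookup by simp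
    have "C' = C" using inner(7) C c encodes_clause_unique by auto
    obtain la preA sufA where la: "a = label la" "suf = preA @ la # sufA"
      using inner(2) by (metis imageE split_list)
    obtain lb preB sufB where lb: "b = label lb" "suf = preB @ lb # sufB"
      using inner(3) by (metis imageE split_list)
    let ?td = "Pair (visit b) (Pair (build c) todo)"
    have "\<exists>m t T lr'.
      (search L ^^ m) (Pair (Pair (visit (label la)) ?td) (Pair out lr)) =
        Pair ?td (Pair (Pair t out) lr') \<and>
      encodes_tree T t \<and> encodes_clause (tree_clause T) (label la) \<and> lemma_tree F S T \<and>
      knows (S \<union> input_clauses T) lr' \<and> distinct (slist lr') \<and>
      set (slist lr') \<subseteq> label ` set (slist L) \<and>
      (if sfst t = Atom then lr' = lr else length (slist lr) < length (slist lr')) \<and>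
      length (postorder T) \<le> 2 * length sufA * (length (slist lr') - length (slist lr)) + 1 \<and>
      m \<le> 2 * length (postorder T)"
      using less.prems la by (intro less.hyps[where pre = "pre @ l # preA"]) auto
    then obtain m1 t1 T1 lr1 where r1:
      "(search L ^^ m1) (Pair (Pair (visit a) ?td) (Pair out lr)) = Pair ?td (Pair (Pair t1 out) lr1)"
      "encodes_tree T1 t1" "encodes_clause (tree_clause T1) a" "lemma_tree F S T1"
      "knows (S \<union> input_clauses T1) lr1" "distinct (slist lr1)"
      "set (slist lr1) \<subseteq> label ` set (slist L)"
      "if sfst t1 = Atom then lr1 = lr else length (slist lr) < length (slist lr1)"
      "length (postorder T1) \<le> 2 * length sufA * (length (slist lr1) - length (slist lr)) + 1"
      "m1 \<le> 2 * length (postorder T1)"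
      unfolding la(1) by blast
    have "\<exists>m t T lr'.
      (search L ^^ m) (Pair (Pair (visit (label lb)) (Pair (build c) todo)) (Pair (Pair t1 out) lr1)) =
        Pair (Pair (build c) todo) (Pair (Pair t (Pair t1 out)) lr') \<and>
      encodes_tree T t \<and> encodes_clause (tree_clause T) (label lb) \<and>
      lemma_tree F (S \<union> input_clauses T1) T \<and>
      knows (S \<union> input_clauses T1 \<union> input_clauses T) lr' \<and> distinct (slist lr') \<and>
      set (slist lr') \<subseteq> label ` set (slist L) \<and>
      (if sfst t = Atom then lr' = lr1 else length (slist lr1) < length (slist lr')) \<and>
      length (postorder T) \<le> 2 * length sufB * (length (slist lr') - length (slist lr1)) + 1 \<and>
      m \<le> 2 * length (postorder T)"
      using less.prems(1) r1(5-7) lb by (intro less.hyps[where pre = "pre @ l # preB"]) auto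
    then obtain m2 t2 T2 lr2 where r2:
      "(search L ^^ m2) (Pair ?td (Pair (Pair t1 out) lr1)) =
        Pair (Pair (build c) todo) (Pair (Pair t2 (Pair t1 out)) lr2)"
      "encodes_tree T2 t2" "encodes_clause (tree_clause T2) b"
      "lemma_tree F (S \<union> input_clauses T1) T2"
      "knows (S \<union> input_clauses T1 \<union> input_clauses T2) lr2" "distinct (slist lr2)"
      "set (slist lr2) \<subseteq> label ` set (slist L)"
      "if sfst t2 = Atom then lr2 = lr1 else length (slist lr1) < length (slist lr2)"
      "length (postorder T2) \<le> 2 * length sufB * (length (slist lr2) - length (slist lr1)) + 1"
      "m2 \<le> 2 * length (postorder T2)"
      unfolding lb(1) by blast
    define T t leaves lr' where "T = Node T1 x C T2" and "t = Pair (Pair t1 t2) (Pair (enc_binary x) c)"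
      and "leaves \<longleftrightarrow> sfst t1 = Atom \<and> sfst t2 = Atom" and "lr' = (if leaves then Pair c lr2 else lr2)"
    \<comment> \<open>One step expands the visit, \<open>m1\<close> and \<open>m2\<close> steps
      settle the two premises, and one step builds the node.\<close>
    have run: "(search L ^^ (1 + m2 + m1 + 1)) (Pair (Pair (visit (label l)) todo) (Pair out lr)) =
        Pair todo (Pair (Pair t out) lr')"
    proof -
      have "search L (Pair (Pair (visit (label l)) todo) (Pair out lr)) =
          Pair (Pair (visit a) ?td) (Pair out lr)"
        using False inner(1) c by (simp add: search_visit lookup_c)
      moreover have "search L (Pair (Pair (build c) todo) (Pair (Pair t2 (Pair t1 out)) lr2)) =
          Pair todo (Pair (Pair t out) lr')"
        using lookup_c inner(1) by (simp add: search_build t_def lr'_def leaves_def)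
      ultimately show ?thesis
        using r1(1) r2(1) by (simp only: funpow_add comp_apply One_nat_def funpow.simps id_apply)
    qed
    have clauses: "tree_clause T1 = A" "tree_clause T2 = B"
      using r1(3) r2(3) inner(5,6) encodes_clause_unique by blast+
    have inf: "inferred resolution x (tree_clause T1) (tree_clause T2) C"
      using inner(8) by (simp add: clauses inferred_def \<open>C' = C\<close>)
    have leaf: "\<exists>D. U = Leaf D" if "encodes_tree U u" "sfst u = Atom" for U u
      using that by (cases U) auto
    have knows: "knows (S \<union> input_clauses T) lr'"
    proof -
      have "\<exists>D \<in> S \<union> input_clauses T. encodes_clause D y" if "y \<in> set (slist lr2)" for y
        using r2(5) that input_clauses_Node[of T1 T2 x C] unfolding knows_def T_def by blast
      moreover have "C \<in> input_clauses T" if leaves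
      proof -
        have "\<exists>D. T1 = Leaf D" "\<exists>D. T2 = Leaf D"
          using leaf r1(2) r2(2) \<open>leaves\<close> by (auto simp: leaves_def)
        then have "input_resolution_tree T" using inf by (auto simp: T_def)
        then show ?thesis
          unfolding input_clauses_def using root_in_postorder[of T]
          by (auto intro!: exI[of _ T] simp: T_def)
      qed
      ultimately show ?thesis using C c unfolding knows_def lr'_def by auto
    qed
    \<comment> \<open>If both premises became leaves, nothing has been learned since the visit
      began, so the clause is still new.\<close>
    have old: "lr1 = lr" "lr2 = lr" if leaves
      using that r1(8) r2(8) by (auto simp: leaves_def)
    have distinct: "distinct (slist lr')"
      using r2(6) old(2) False c by (auto simp: lr'_def)
    have labels: "set (slist lr') \<subseteq> label ` set (slist L)"
      using r2(7) l c by (auto simp: lr'_def)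
    let ?n = "\<lambda>lr. length (slist lr)"
    have le: "?n lr \<le> ?n lr1" "?n lr1 \<le> ?n lr2"
      using r1(8) r2(8) by (auto split: if_splits)
    \<comment> \<open>Either a premise has learned something, or both are leaves and the clause
      itself is learned.\<close>
    have less: "?n lr < ?n lr'"
      using r1(8) r2(8) le old(2) by (auto simp: lr'_def leaves_def split: if_splits)
    \<comment> \<open>Both premises lie further back in the list, so their bounds use
      \<open>h\<close>; with the new node they add up to at most \<open>2 * h * d + 3\<close>, where
      \<open>d\<close> is the gain in learned clauses. As \<open>d\<close> is positive, passing from
      \<open>h\<close> to \<open>Suc h\<close> absorbs the surplus 2.\<close>
    have size: "length (postorder T) \<le> 2 * length suf * (?n lr' - ?n lr) + 1"
    proof -
      obtain h where h: "length suf = Suc h" "length sufA \<le> h" "length sufB \<le> h"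
        using la(2) lb(2) by (metis add_leD2 length_Cons length_append not_less_eq_eq le_add2
          less_eq_Suc_le Suc_le_D Suc_le_mono)
      have "length (postorder T1) \<le> 2 * h * (?n lr1 - ?n lr) + 1"
        using r1(9) h(2) by (meson add_le_mono1 le_trans mult_le_mono1 mult_le_mono2)
      moreover have "length (postorder T2) \<le> 2 * h * (?n lr2 - ?n lr1) + 1"
        using r2(9) h(3) by (meson add_le_mono1 le_trans mult_le_mono1 mult_le_mono2)
      moreover have "2 * h * (?n lr1 - ?n lr) + 2 * h * (?n lr2 - ?n lr1) = 2 * h * (?n lr2 - ?n lr)"
        using le by (simp flip: distrib_left)
      ultimately have "length (postorder T) \<le> 2 * h * (?n lr2 - ?n lr) + 3"
        by (simp add: T_def)
      also have "2 * h * (?n lr2 - ?n lr) \<le> 2 * h * (?n lr' - ?n lr)"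
        by (intro mult_le_mono2) (simp add: lr'_def diff_le_mono)
      finally show ?thesis using less h(1) by (simp add: algebra_simps)
    qed
    have "sfst t \<noteq> Atom" by (simp add: t_def)
    moreover have "encodes_tree T t" "encodes_clause (tree_clause T) (label l)" "lemma_tree F S T"
      using r1(2,4) r2(2,4) C c inf by (auto simp: T_def t_def)
    moreover have "1 + m2 + m1 + 1 \<le> 2 * length (postorder T)"
      using r1(10) r2(10) by (simp add: T_def)
    ultimately show ?thesis
      using run knows distinct labels less size
      by (intro exI[of _ "1 + m2 + m1 + 1"] exI[of _ t] exI[of _ T] exI[of _ lr']) simp
  qed
qed

lemma search_done: "sfst s = Atom \<Longrightarrow> (search L ^^ m) s = s"
  by (induction m) (auto simp: search_def)

text \<open>Learned clauses are distinct labels of \<open>L\<close>, so there are at most as many as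
  lines. This turns the bound from the search into a quadratic one.\<close>

lemma RTI_tree_of:
  assumes der: "derivation F (slist L)" and empty: "Atom \<in> label ` set (slist L)"
  shows "\<exists>\<pi>. encodes \<pi> (tree_of L) \<and> RTI F \<pi> \<and>
    refutation_size \<pi> \<le> 2 * length (slist L) * length (slist L) + 1"
proof -
  let ?n = "length (slist L)" and ?s = "Pair (Pair (visit Atom) Atom) (Pair Atom Atom)"
  obtain l pre suf where l: "label l = Atom" "slist L = pre @ l # suf"
    using empty by (metis imageE split_list)
  have "knows {} Atom" by (simp add: knows_def)
  from search_run[OF der l(2) this, of Atom Atom, unfolded l(1)]
  obtain m t T lr' where run: "(search L ^^ m) ?s = Pair Atom (Pair (Pair t Atom) lr')"
    and T: "encodes_tree T t" "encodes_clause (tree_clause T) Atom" "lemma_tree F {} T"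
    and lr': "distinct (slist lr')" "set (slist lr') \<subseteq> label ` set (slist L)"
    and size: "length (postorder T) \<le> 2 * length suf * length (slist lr') + 1"
      "m \<le> 2 * length (postorder T)"
    by auto
  have "length (slist lr') \<le> card (label ` set (slist L))"
    using lr' card_mono[OF _ lr'(2)] by (simp add: distinct_card)
  also have "\<dots> \<le> ?n"
    using card_image_le[of "set (slist L)" label] card_length[of "slist L"] by simp
  finally have "2 * length suf * length (slist lr') \<le> 2 * length suf * ?n"
    by (rule mult_le_mono2)
  with size(1) have po: "length (postorder T) \<le> 2 * length suf * ?n + 1" by linarith
  have suf: "Suc (length suf) \<le> ?n" using l(2) by simp
  \<comment> \<open>The line of the empty clause is not in \<open>suf\<close>. The
    \<open>2 * ?n\<close> saved this way pays for the summand 1 in the size, so that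
    \<open>4 * ?n * ?n\<close> steps suffice.\<close>
  then have "2 * length suf * ?n + 2 * ?n \<le> 2 * ?n * ?n"
    by (metis add_mult_distrib mult_Suc mult_le_mono add.commute le_refl mult.assoc distrib_left
        mult_Suc_right)
  with po suf have bound: "length (postorder T) \<le> 2 * ?n * ?n + 1" "2 * length (postorder T) \<le> 4 * ?n * ?n"
    by simp_all
  have four: "(\<lambda>s. search L (search L (search L (search L s)))) = search L ^^ 4"
    by (simp add: eval_nat_numeral fun_eq_iff)
  have "m \<le> 4 * ?n * ?n" using size(2) bound(2) by linarith
  then obtain k where "4 * ?n * ?n = k + m" by (metis le_add_diff_inverse2)
  then have "((((\<lambda>s. search L (search L (search L (search L s)))) ^^ ?n) ^^ ?n) ?s) =
      (search L ^^ k) ((search L ^^ m) ?s)"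
    unfolding four funpow_mult by (simp add: funpow_add)
  also have "\<dots> = Pair Atom (Pair (Pair t Atom) lr')"
    unfolding run by (rule search_done) simp
  finally have "tree_of L = Pair (Pair Atom Atom) t"
    unfolding tree_of_def by simp
  then have "encodes (Tree T) (tree_of L)" using T(1) by (simp add: enc_bool_def)
  moreover have "RTI F (Tree T)" using RTI_lemma_tree T(2,3) by simp
  ultimately show ?thesis using bound(1) by (intro exI[of _ "Tree T"]) simp
qed

section \<open>The simulations\<close>

lemma inferred_resolution_imp_w_resolution: "inferred resolution x C D E \<Longrightarrow> inferred w_resolution x C D E"
  by (auto simp: inferred_def resolution_def w_resolution_def)

lemma dag_derivation_mono:
  assumes "dag_derivation rl F D" and "\<And>x A B C. inferred rl x A B C \<Longrightarrow> inferred rl' x A B C"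
  shows "dag_derivation rl' F D"
  unfolding dag_derivation_def
proof (intro conjI allI impI)
  show "acyclic (dag_edges D)" using assms(1) by (simp add: dag_derivation_def)
  fix k assume k: "k < length D"
  from assms(1) have "\<forall>k < length D. case D ! k of Source C \<Rightarrow> C \<in> F
      | Inner i j x C \<Rightarrow> i < length D \<and> j < length D \<and> i \<noteq> j \<and>
          inferred rl x (node_clause (D ! i)) (node_clause (D ! j)) C"
    by (simp add: dag_derivation_def)
  from this[rule_format, OF k] show "case D ! k of Source C \<Rightarrow> C \<in> F
      | Inner i j x C \<Rightarrow> i < length D \<and> j < length D \<and> i \<noteq> j \<and>
          inferred rl' x (node_clause (D ! i)) (node_clause (D ! j)) C"
    by (cases "D ! k") (auto intro: assms(2))
qed

lemma tree_derivation_mono: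
  assumes "tree_derivation adm rl F T" and "\<And>x A B C. inferred rl x A B C \<Longrightarrow> inferred rl' x A B C"
    and "\<And>T. adm T \<Longrightarrow> adm' T"
  shows "tree_derivation adm' rl' F T"
  unfolding tree_derivation_def
proof (intro allI impI)
  fix v assume v: "v < length (postorder T)"
  from assms(1)[unfolded tree_derivation_def, rule_format, OF v]
  show "case postorder T ! v of
      Leaf C \<Rightarrow> C \<in> F \<or> (\<exists>u<v. adm' (postorder T ! u) \<and> tree_clause (postorder T ! u) = C)
    | Node l x C r \<Rightarrow> inferred rl' x (tree_clause l) (tree_clause r) C"
    by (cases "postorder T ! v") (auto intro: assms(2,3))
qed

lemma RD_imp_WRD: "RD F \<pi> \<Longrightarrow> WRD F \<pi>"
  unfolding RD_def WRD_def dag_refutation_def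
  using dag_derivation_mono inferred_resolution_imp_w_resolution by blast

lemma tree_refutation_mono:
  assumes "tree_refutation adm rl F T" and "\<And>x A B C. inferred rl x A B C \<Longrightarrow> inferred rl' x A B C"
    and "\<And>T. adm T \<Longrightarrow> adm' T"
  shows "tree_refutation adm' rl' F T"
  using assms tree_derivation_mono unfolding tree_refutation_def by metis

lemma RTI_imp_WRTI: "RTI F \<pi> \<Longrightarrow> WRTI F \<pi>"
  unfolding RTI_def WRTI_def
  by (auto elim!: tree_refutation_mono intro: inferred_resolution_imp_w_resolution)

lemma RTI_imp_RTL: "RTI F \<pi> \<Longrightarrow> RTL F \<pi>"
  unfolding RTI_def RTL_def by (auto elim!: tree_refutation_mono)

lemma WRTI_imp_WRTL: "WRTI F \<pi> \<Longrightarrow> WRTL F \<pi>"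
  unfolding WRTI_def WRTL_def by (auto elim!: tree_refutation_mono)

lemma RTL_imp_WRTL: "RTL F \<pi> \<Longrightarrow> WRTL F \<pi>"
  unfolding RTL_def WRTL_def
  by (auto elim!: tree_refutation_mono intro: inferred_resolution_imp_w_resolution)

lemma saturate_refutation:
  assumes "WRD F \<pi> \<or> WRTL F \<pi>" "encodes \<pi> v"
  shows "derivation F (slist (saturate (items v)))"
    and "Atom \<in> label ` set (slist (saturate (items v)))"
    and "length (slist (saturate (items v))) \<le> refutation_size \<pi>"
  using assms saturate_dag saturate_tree by blast+

lemma p_simulatesI:
  assumes "ptime f" and "\<And>F \<pi> v. R F \<pi> \<Longrightarrow> encodes \<pi> v \<Longrightarrow>
    \<exists>\<pi>'. encodes \<pi>' (f v) \<and> Q F \<pi>' \<and> refutation_size \<pi>' \<le> poly p (refutation_size \<pi>)"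
  shows "p_simulates Q R"
  using assms unfolding p_simulates_def ptime_def poly_time_on_def by blast

lemma RD_p_simulates:
  assumes "\<And>F \<pi>. R F \<pi> \<Longrightarrow> WRD F \<pi> \<or> WRTL F \<pi>" and "\<And>F \<pi>. RD F \<pi> \<Longrightarrow> Q F \<pi>"
  shows "p_simulates Q R"
\<comment> \<open>The identity polynomial: each given node accounts for at most one dag
  node.\<close>
proof (rule p_simulatesI[where p = "[:0, 1:]"])
  show "ptime (\<lambda>v. dag_of (saturate (items v)))"
    by (intro ptime_dag_of ptime_saturate ptime_items)
  fix F \<pi> v assume "R F \<pi>" "encodes \<pi> v"
  then show "\<exists>\<pi>'. encodes \<pi>' (dag_of (saturate (items v))) \<and> Q F \<pi>' \<and>
      refutation_size \<pi>' \<le> poly [:0, 1:] (refutation_size \<pi>)"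
    using saturate_refutation[of F \<pi> v] RD_dag_of[of F "saturate (items v)"] assms by fastforce
qed

lemma RTI_p_simulates:
  assumes "\<And>F \<pi>. R F \<pi> \<Longrightarrow> WRD F \<pi> \<or> WRTL F \<pi>" and "\<And>F \<pi>. RTI F \<pi> \<Longrightarrow> Q F \<pi>"
  shows "p_simulates Q R"
\<comment> \<open>This is \<open>2 * n * n + 1\<close>, the quadratic bound of the unfolding at the
  number of given nodes.\<close>
proof (rule p_simulatesI[where p = "[:1, 0, 2:]"])
  show "ptime (\<lambda>v. tree_of (saturate (items v)))"
    by (intro ptime_tree_of ptime_saturate ptime_items)
  fix F \<pi> v assume "R F \<pi>" "encodes \<pi> v"
  then have v: "WRD F \<pi> \<or> WRTL F \<pi>" "encodes \<pi> v" using assms(1) by blast+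
  note L = saturate_refutation[OF v]
  obtain \<pi>' where \<pi>': "encodes \<pi>' (tree_of (saturate (items v)))" "RTI F \<pi>'"
      "refutation_size \<pi>' \<le> 2 * length (slist (saturate (items v))) *
        length (slist (saturate (items v))) + 1"
    using RTI_tree_of[OF L(1,2)] by blast
  note \<pi>'(3)
  also have "2 * length (slist (saturate (items v))) * length (slist (saturate (items v))) + 1
      \<le> 2 * refutation_size \<pi> * refutation_size \<pi> + 1"
    using L(3) by (intro add_mono mult_le_mono order_refl)
  finally show "\<exists>\<pi>'. encodes \<pi>' (tree_of (saturate (items v))) \<and> Q F \<pi>' \<and>
      refutation_size \<pi>' \<le> poly [:1, 0, 2:] (refutation_size \<pi>)"
    using \<pi>'(1,2) assms(2) by (intro exI[of _ \<pi>']) (simp add: algebra_simps)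
qed

theorem theorem3p4:
  "\<forall>Q \<in> {RD, WRD, RTI, WRTI, RTL, WRTL}. \<forall>R \<in> {RD, WRD, RTI, WRTI, RTL, WRTL}.
     p_equivalent Q R"
proof -
  have sim: "p_simulates Q R" if "Q \<in> {RD, WRD, RTI, WRTI, RTL, WRTL}"
    "R \<in> {RD, WRD, RTI, WRTI, RTL, WRTL}" for Q R
  proof -
    have R: "WRD F \<pi> \<or> WRTL F \<pi>" if "R F \<pi>" for F \<pi>
      using \<open>R \<in> _\<close> that RD_imp_WRD RTI_imp_RTL WRTI_imp_WRTL RTL_imp_WRTL by auto
    consider "\<And>F \<pi>. RD F \<pi> \<Longrightarrow> Q F \<pi>" | "\<And>F \<pi>. RTI F \<pi> \<Longrightarrow> Q F \<pi>"
      using \<open>Q \<in> _\<close> RD_imp_WRD RTI_imp_WRTI RTI_imp_RTL WRTI_imp_WRTL by auto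
    then show ?thesis
      using R RD_p_simulates RTI_p_simulates by cases blast+
  qed
  then show ?thesis unfolding p_equivalent_def by blast
qed

end
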